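(* For $i \in \{1,2\}$ let $s_i \ge 1$, $t_i \ge 0$, $s_i + t_i \ge 2$, and let $f_{1,1}, \ldots, f_{1,s_1}, g_{1,1}, \ldots, g_{1,t_1}, f_{2,1}, \ldots, f_{2,s_2}, g_{2,1}, \ldots, g_{2,t_2} \in \mathbb{Z}(X)$ be sum-type expressions such that $\operatorname{Var}(f_{1,1}), \ldots, \operatorname{Var}(f_{1,s_1}), \operatorname{Var}(g_{1,1}), \ldots, \operatorname{Var}(g_{1,t_1})$ are mutually disjoint and $\operatorname{Var}(f_{2,1}), \ldots, \operatorname{Var}(f_{2,s_2}), \operatorname{Var}(g_{2,1}), \ldots, \operatorname{Var}(g_{2,t_2})$ are mutually disjoint, and suppose $\frac{\prod_{i=1}^{s_1} f_{1,i}}{\prod_{i=1}^{t_1} g_{1,i}}$ and $\frac{\prod_{i=1}^{s_2} f_{2,i}}{\prod_{i=1}^{t_2} g_{2,i}}$ are product-type expressions of positive depth. Then these two fractions are equal up to sign if and only if $s_2 = s_1$, $t_2 = t_1$, and there exist permutations $\pi$ of $\{1,\dots,s_1\}$ and $\sigma$ of $\{1,\dots,t_1\}$ such that $f_{2,\pi(i)}$ and $f_{1,i}$ are equal up to sign for every $1 \le i \le s_1$, and $g_{2,\sigma(j)}$ and $g_{1,j}$ are equal up to sign for every $1 \le j \le t_1$.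
   Context: Let $X = \{x_1, x_2, \ldots\}$ be a countably infinite set of formal variables, $\mathbb{Z}[X]$ the integer polynomial ring and $\mathbb{Z}(X)$ its field of fractions. Two elements $a,b$ are equal up to sign if $a = b$ or $a = -b$. For $f \in \mathbb{Z}(X)$ with canonical representation $f = \frac{P}{Q}$ ($P,Q$ coprime, $Q \ne 0$), $\operatorname{Var}(f)$ is the set of variables $x_i$ that occur with positive exponent in some monomial with nonzero coefficient of $P$ or of $Q$. Sum-type and product-type expressions of depth $0$ are the elements $x_i$ and $-x_i$, $i \in \mathbb{N}$. For $k \in \mathbb{N}$: a sum-type expression of depth $k$ is an $f \in \mathbb{Z}(X)$ that can be written as $f = \sum_{i=1}^s f_i$ with $s \ge 2$, where the nonzero $f_1,\dots,f_s$ are all product-type expressions of depth at most $k-1$, at least one of depth exactly $k-1$, and $\operatorname{Var}(f_1),\dots,\operatorname{Var}(f_s)$ are mutually disjoint. A product-type expression of depth $k$ is an $f \in \mathbb{Z}(X)$ that can be written as $f = \frac{\prod_{i=1}^s f_i}{\prod_{i=1}^t g_i}$ with $s \ge 1$, $t \ge 0$, $s+t \ge 2$, where the nonzero $f_1,\dots,f_s,g_1,\dots,g_t$ are all sum-type expressions of depth at most $k-1$, at least one of depth exactly $k-1$, and $\operatorname{Var}(f_1),\dots,\operatorname{Var}(f_s),\operatorname{Var}(g_1),\dots,\operatorname{Var}(g_t)$ are mutually disjoint. A sum-type (resp. product-type) expression is one of some depth $k \in \mathbb{N}_0$. An empty product equals $1$. *)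

theory Defs
  imports
    "HOL-Library.Poly_Mapping"
    "HOL-Library.Disjoint_Sets"
    "HOL-Computational_Algebra.Fraction_Field"
    "HOL-Combinatorics.Permutations"
begin

text \<open>
  The integer polynomial ring in the variables \<open>x\<^sub>0, x\<^sub>1, \<dots>\<close>: a monomial is a finitely supported
  map from variable indices to exponents, a polynomial a finitely supported map from monomials to
  coefficients.
\<close>

type_synonym zpoly = "(nat \<Rightarrow>\<^sub>0 nat) \<Rightarrow>\<^sub>0 int"

type_synonym zfrac = "zpoly fract"

definition zvar :: "nat \<Rightarrow> zfrac" where
  "zvar i = Fract (Poly_Mapping.single (Poly_Mapping.single i 1) 1) 1"

definition poly_vars :: "zpoly \<Rightarrow> nat set" where
  "poly_vars P = (\<Union>m \<in> Poly_Mapping.keys P. Poly_Mapping.keys m)"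

text \<open>
  The constant \<open>coprime\<close> of the library needs the class \<open>algebraic_semidom\<close>, of which
  \<open>zpoly\<close> is not an instance.
\<close>

definition zpoly_coprime :: "zpoly \<Rightarrow> zpoly \<Rightarrow> bool" where
  "zpoly_coprime P Q \<longleftrightarrow> (\<forall>D. D dvd P \<longrightarrow> D dvd Q \<longrightarrow> D dvd 1)"

text \<open>
  The canonical representation of a fraction is unique up to a common sign of numerator and
  denominator, which does not affect the variables that occur. It is therefore immaterial that
  \<open>P\<close> and \<open>Q\<close> range over all canonical representations here.
\<close>

definition Var :: "zfrac \<Rightarrow> nat set" where
  "Var f = {i. \<exists>P Q. Q \<noteq> 0 \<and> zpoly_coprime P Q \<and> f = Fract P Q \<and> i \<in> poly_vars P \<union> poly_vars Q}"

definition eq_up_to_sign :: "zfrac \<Rightarrow> zfrac \<Rightarrow> bool" where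
  "eq_up_to_sign a b \<longleftrightarrow> a = b \<or> a = - b"

definition vars_disjoint :: "nat \<Rightarrow> (nat \<Rightarrow> zfrac) \<Rightarrow> nat \<Rightarrow> (nat \<Rightarrow> zfrac) \<Rightarrow> bool" where
  "vars_disjoint s f t g \<longleftrightarrow>
     disjoint_family_on (\<lambda>i. Var (f i)) {1..s} \<and>
     disjoint_family_on (\<lambda>j. Var (g j)) {1..t} \<and>
     (\<forall>i\<in>{1..s}. \<forall>j\<in>{1..t}. Var (f i) \<inter> Var (g j) = {})"

text \<open>
  \<open>sum_type k f\<close> and \<open>prod_type k f\<close>: \<open>f\<close> is a sum-type, respectively product-type, expression of
  depth \<open>k\<close>. Every rule derives a depth from strictly smaller depths, so this inductive definition
  agrees with the simultaneous recursion on the depth.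
\<close>

inductive sum_type :: "nat \<Rightarrow> zfrac \<Rightarrow> bool" and prod_type :: "nat \<Rightarrow> zfrac \<Rightarrow> bool" where
  sum_var: "sum_type 0 (zvar i)"
| sum_neg_var: "sum_type 0 (- zvar i)"
| prod_var: "prod_type 0 (zvar i)"
| prod_neg_var: "prod_type 0 (- zvar i)"
| sum: "sum_type (Suc k) (\<Sum>i=1..s::nat. f i)"
    if "s \<ge> 2"
      and "\<forall>i\<in>{1..s}. f i \<noteq> 0 \<and> (\<exists>l\<le>k. prod_type l (f i))"
      and "\<exists>i\<in>{1..s}. prod_type k (f i)"
      and "disjoint_family_on (\<lambda>i. Var (f i)) {1..s}"
| prod: "prod_type (Suc k) ((\<Prod>i=1..s. f i) / (\<Prod>j=1..t. g j))"
    if "s \<ge> 1" and "s + t \<ge> 2"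
      and "\<forall>i\<in>{1..s}. f i \<noteq> 0 \<and> (\<exists>l\<le>k. sum_type l (f i))"
      and "\<forall>j\<in>{1..t}. g j \<noteq> 0 \<and> (\<exists>l\<le>k. sum_type l (g j))"
      and "(\<exists>i\<in>{1..s}. sum_type k (f i)) \<or> (\<exists>j\<in>{1..t}. sum_type k (g j))"
      and "vars_disjoint s f t g"

definition is_sum_type :: "zfrac \<Rightarrow> bool" where
  "is_sum_type f \<longleftrightarrow> (\<exists>k. sum_type k f)"

end

theory Submission
  imports Defs
begin

text \<open>
  Transposing two variables is an automorphism of \<open>\<int>(X)\<close>, and an element depends on a variable
  precisely if transposing it with a fresh variable changes the element. Let \<open>u, w\<close> be distinct
  variables of \<open>f\<close>, let \<open>\<sigma>, \<tau>\<close> exchange them with fresh variables, and consider the relations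
  \<open>f + \<sigma>\<tau>f = \<sigma>f + \<tau>f\<close> and \<open>f \<cdot> \<sigma>\<tau>f = \<sigma>f \<cdot> \<tau>f\<close>. The first holds if \<open>u, w\<close> lie in different summands of a
  sum of expressions in disjoint variables, the second if they lie in different factors of a product;
  together they give \<open>(f - \<sigma>f)(f - \<tau>f) = 0\<close>, so they exclude each other. Hence a sum-type expression has
  no nontrivial factorization into factors in disjoint variables, the variable sets of the factors of
  a product-type expression are determined by the expression, and matching factors differ by a
  constant. In the same way \<open>f\<close> and \<open>c / f\<close> cannot both be sum-type, so numerators are not matched
  with denominators. Finally, in every expression numerator and denominator have distinct leading
  monomials and leading coefficients of equal absolute value, which forces the constants to be \<open>\<plusminus>1\<close>.
\<close>

subsection \<open>Leading terms and canonical representations\<close>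

text \<open>The maximum refers to the lexicographic order on finitely supported maps, in which the
  least index where two monomials differ decides. This order is total and compatible with
  addition.\<close>

definition lead_monom :: "zpoly \<Rightarrow> nat \<Rightarrow>\<^sub>0 nat" where
  "lead_monom P = Max (Poly_Mapping.keys P)"

definition lead_coef :: "zpoly \<Rightarrow> int" where
  "lead_coef P = Poly_Mapping.lookup P (lead_monom P)"

lemma lead_monom_in_keys: "P \<noteq> 0 \<Longrightarrow> lead_monom P \<in> Poly_Mapping.keys P"
  unfolding lead_monom_def by (intro Max_in) auto

lemma lead_coef_nonzero: "P \<noteq> 0 \<Longrightarrow> lead_coef P \<noteq> 0"
  using lead_monom_in_keys[of P] by (simp add: lead_coef_def in_keys_iff)

lemma le_lead_monom: "m \<in> Poly_Mapping.keys P \<Longrightarrow> m \<le> lead_monom P"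
  unfolding lead_monom_def by (intro Max_ge) auto

lemma lead_monom_eqI:
  assumes "m \<in> Poly_Mapping.keys P" "\<And>k. k \<in> Poly_Mapping.keys P \<Longrightarrow> k \<le> m"
  shows "lead_monom P = m"
  unfolding lead_monom_def using assms by (intro Max_eqI) auto

text \<open>Any other pair of monomials of \<open>P\<close> and \<open>Q\<close> has a strictly
  smaller sum, so a single product contributes to this coefficient.\<close>

lemma lookup_mult_lead:
  "Poly_Mapping.lookup (P * Q) (lead_monom P + lead_monom Q) = lead_coef P * lead_coef Q"
proof -
  let ?p = "lead_monom P" and ?q = "lead_monom Q"
  have inner: "Poly_Mapping.lookup P l * (\<Sum>q. Poly_Mapping.lookup Q q when ?p + ?q = l + q)
      = (lead_coef P * lead_coef Q when l = ?p)" for l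
  proof (cases "l = ?p")
    case True
    have "(\<Sum>q. Poly_Mapping.lookup Q q when ?p + ?q = l + q) = (\<Sum>q. Poly_Mapping.lookup Q q when q = ?q)"
      using True by (intro Sum_any.cong) (auto simp: when_def)
    then show ?thesis using True by (simp add: lead_coef_def)
  next
    case False
    show ?thesis
    proof (cases "l \<in> Poly_Mapping.keys P")
      case True
      then have "l < ?p" using False le_lead_monom[OF True] by simp
      have "(Poly_Mapping.lookup Q q when ?p + ?q = l + q) = 0" for q
      proof (cases "q \<in> Poly_Mapping.keys Q")
        case True
        then have "l + q < ?p + ?q"
          using \<open>l < ?p\<close> le_lead_monom[OF True] by (intro add_less_le_mono)
        then show ?thesis by (auto simp: when_def)
      qed (simp add: in_keys_iff when_def)
      then show ?thesis using False by simp
    qed (simp add: in_keys_iff False)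
  qed
  show ?thesis unfolding lookup_mult inner by simp
qed

lemma lead_monom_single [simp]: "v \<noteq> 0 \<Longrightarrow> lead_monom (Poly_Mapping.single m v) = m"
  by (simp add: lead_monom_def)

lemma lead_coef_single [simp]: "v \<noteq> 0 \<Longrightarrow> lead_coef (Poly_Mapping.single m v) = v"
  by (simp add: lead_coef_def)

lemma lead_monom_one [simp]: "lead_monom 1 = 0"
  by (simp add: lead_monom_def)

lemma lead_coef_one [simp]: "lead_coef 1 = 1"
  by (simp add: lead_coef_def)

lemma lead_monom_mult:
  assumes "P \<noteq> 0" "Q \<noteq> 0"
  shows "lead_monom (P * Q) = lead_monom P + lead_monom Q"
proof (rule lead_monom_eqI)
  show "lead_monom P + lead_monom Q \<in> Poly_Mapping.keys (P * Q)"
    using lookup_mult_lead[of P Q] lead_coef_nonzero[OF assms(1)] lead_coef_nonzero[OF assms(2)]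
    by (simp add: in_keys_iff)
next
  fix k assume "k \<in> Poly_Mapping.keys (P * Q)"
  then obtain a b where "k = a + b" "a \<in> Poly_Mapping.keys P" "b \<in> Poly_Mapping.keys Q"
    using keys_mult[of P Q] by auto
  then show "k \<le> lead_monom P + lead_monom Q"
    using le_lead_monom by (auto intro: add_mono)
qed

lemma lead_coef_mult: "lead_coef (P * Q) = lead_coef P * lead_coef Q"
proof (cases "P = 0 \<or> Q = 0")
  case True
  then show ?thesis by (auto simp: lead_coef_def)
next
  case False
  then show ?thesis
    using lookup_mult_lead[of P Q] lead_monom_mult[of P Q] by (simp add: lead_coef_def)
qed

lemma lead_monom_uminus [simp]: "lead_monom (- P) = lead_monom P"
  by (simp add: lead_monom_def)

lemma lead_coef_uminus [simp]: "lead_coef (- P) = - lead_coef P"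
  by (simp add: lead_coef_def)

lemma lead_add_less:
  assumes "P \<noteq> 0" "Q \<noteq> 0" "lead_monom Q < lead_monom P"
  shows "P + Q \<noteq> 0" "lead_monom (P + Q) = lead_monom P" "lead_coef (P + Q) = lead_coef P"
proof -
  have "lead_monom P \<notin> Poly_Mapping.keys Q"
    using le_lead_monom[of "lead_monom P" Q] assms(3) by auto
  then have c: "Poly_Mapping.lookup (P + Q) (lead_monom P) = lead_coef P"
    by (simp add: lookup_add in_keys_iff lead_coef_def)
  then have k: "lead_monom P \<in> Poly_Mapping.keys (P + Q)"
    using lead_coef_nonzero[OF assms(1)] by (simp add: in_keys_iff)
  then show "P + Q \<noteq> 0" by auto
  show l: "lead_monom (P + Q) = lead_monom P"
  proof (rule lead_monom_eqI[OF k])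
    fix m assume "m \<in> Poly_Mapping.keys (P + Q)"
    then show "m \<le> lead_monom P"
      using keys_add[of P Q] le_lead_monom[of m P] le_lead_monom[of m Q] assms(3) by force
  qed
  show "lead_coef (P + Q) = lead_coef P"
    using c l by (simp add: lead_coef_def)
qed

text \<open>The least index with a nonzero exponent in \<open>m\<close> decides the comparison, and
  there the zero monomial is smaller.\<close>

lemma monom_nonneg: "(0 :: nat \<Rightarrow>\<^sub>0 nat) \<le> m"
proof (cases "m = 0")
  case False
  define k where "k = (LEAST k. Poly_Mapping.lookup m k \<noteq> 0)"
  have ex: "\<exists>k. Poly_Mapping.lookup m k \<noteq> 0"
    using False by (metis lookup_zero poly_mapping_eqI)
  have "Poly_Mapping.lookup m k \<noteq> 0" "\<And>l. l < k \<Longrightarrow> Poly_Mapping.lookup m l = 0"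
    unfolding k_def using LeastI_ex[OF ex] not_less_Least by blast+
  then have "0 < m"
    by (auto simp: less_poly_mapping.rep_eq less_fun_def intro!: exI[of _ k])
  then show ?thesis by simp
qed simp

text \<open>The lexicographic order has infinite descending chains, since each variable exceeds
  those of larger index. The total degree provides an additive size in the natural numbers for the
  minimal choice in \<open>canonical_rep_exists\<close>.\<close>

definition monom_degree :: "(nat \<Rightarrow>\<^sub>0 nat) \<Rightarrow> nat" where
  "monom_degree m = (\<Sum>i. Poly_Mapping.lookup m i)"

lemma monom_degree_add: "monom_degree (m + n) = monom_degree m + monom_degree n"
  unfolding monom_degree_def lookup_add by (rule Sum_any.distrib) auto

lemma monom_degree_pos:
  assumes "m \<noteq> 0"
  shows "0 < monom_degree m"
proof -
  obtain i where "Poly_Mapping.lookup m i \<noteq> 0"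
    using assms by (metis lookup_zero poly_mapping_eqI)
  then show ?thesis
    unfolding monom_degree_def Sum_any.expand_set
    by (intro sum_pos2[of _ i]) auto
qed

lemma zpoly_eq_const:
  assumes "lead_monom P = 0"
  shows "P = Poly_Mapping.single 0 (lead_coef P)"
proof (rule poly_mapping_eqI)
  fix k
  show "Poly_Mapping.lookup P k = Poly_Mapping.lookup (Poly_Mapping.single 0 (lead_coef P)) k"
  proof (cases "k = 0")
    case True
    then show ?thesis using assms by (simp add: lead_coef_def)
  next
    case False
    then have "k \<notin> Poly_Mapping.keys P"
      using le_lead_monom[of k P] monom_nonneg[of k] assms by auto
    then show ?thesis using False by (simp add: in_keys_iff lookup_single)
  qed
qed

text \<open>Choose a representation whose denominator minimizes the degree of its leading monomial
  plus the absolute value of its leading coefficient. Cancelling a common divisor \<open>D\<close>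
  increases neither summand, so by minimality \<open>D\<close> has leading monomial \<open>0\<close>
  and leading coefficient \<open>1\<close> or \<open>-1\<close>, which makes it a unit.\<close>

lemma canonical_rep_exists:
  "\<exists>P Q. Q \<noteq> 0 \<and> zpoly_coprime P Q \<and> f = Fract P Q"
proof -
  define \<mu> where "\<mu> Q = monom_degree (lead_monom Q) + nat \<bar>lead_coef Q\<bar>" for Q
  define R where "R PQ \<longleftrightarrow> snd PQ \<noteq> 0 \<and> f = Fract (fst PQ) (snd PQ)" for PQ
  obtain P0 Q0 where "R (P0, Q0)"
    by (cases f) (auto simp: R_def)
  define PQ where "PQ = (ARG_MIN (\<lambda>x. \<mu> (snd x)) x. R x)"
  have PQ: "R PQ" and min: "\<And>x. R x \<Longrightarrow> \<mu> (snd PQ) \<le> \<mu> (snd x)"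
    unfolding PQ_def using \<open>R (P0, Q0)\<close>
    by (auto intro: arg_min_natI[of R _ "\<lambda>x. \<mu> (snd x)"] arg_min_nat_le[of R _ "\<lambda>x. \<mu> (snd x)"])
  obtain P Q where eq: "PQ = (P, Q)" by fastforce
  have "D dvd 1" if D: "D dvd P" "D dvd Q" for D
  proof -
    obtain P' Q' where P': "P = D * P'" and Q': "Q = D * Q'"
      using D by (auto elim!: dvdE)
    have nz: "D \<noteq> 0" "Q' \<noteq> 0" using PQ Q' by (auto simp: R_def eq)
    have "R (P', Q')"
      using PQ nz by (simp add: R_def eq P' Q' mult_fract_cancel)
    then have le: "\<mu> Q \<le> \<mu> Q'" using min eq by force
    have lc: "\<bar>lead_coef D\<bar> \<ge> 1" "\<bar>lead_coef Q'\<bar> \<ge> 1"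
      using nz lead_coef_nonzero by force+
    have "\<bar>lead_coef Q\<bar> = \<bar>lead_coef D\<bar> * \<bar>lead_coef Q'\<bar>"
      by (simp add: Q' lead_coef_mult abs_mult)
    moreover have "1 * \<bar>lead_coef Q'\<bar> \<le> \<bar>lead_coef D\<bar> * \<bar>lead_coef Q'\<bar>"
      using lc by (intro mult_right_mono) auto
    ultimately have ge: "\<bar>lead_coef Q'\<bar> \<le> \<bar>lead_coef Q\<bar>" by simp
    moreover have deg: "monom_degree (lead_monom Q) = monom_degree (lead_monom D) + monom_degree (lead_monom Q')"
      using nz by (simp add: Q' lead_monom_mult monom_degree_add)
    ultimately have "monom_degree (lead_monom D) = 0" "\<bar>lead_coef Q\<bar> = \<bar>lead_coef Q'\<bar>"
      using le by (auto simp: \<mu>_def)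
    then have "lead_monom D = 0" "\<bar>lead_coef D\<bar> = 1"
      using monom_degree_pos[of "lead_monom D"] lc \<open>\<bar>lead_coef Q\<bar> = \<bar>lead_coef D\<bar> * \<bar>lead_coef Q'\<bar>\<close>
      by auto
    then have "D = 1 \<or> D = - 1"
      using zpoly_eq_const[of D] by (auto simp: abs_if single_uminus split: if_splits)
    then show ?thesis by auto
  qed
  then have "zpoly_coprime P Q" by (simp add: zpoly_coprime_def)
  then show ?thesis using PQ by (auto simp: R_def eq)
qed

subsection \<open>Transposition of variables\<close>

text \<open>\<open>map_key\<close> precomposes with its argument; since a transposition is its own
  inverse, this agrees with renaming the variables.\<close>

definition monom_swap :: "nat \<Rightarrow> nat \<Rightarrow> (nat \<Rightarrow>\<^sub>0 nat) \<Rightarrow> nat \<Rightarrow>\<^sub>0 nat" where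
  "monom_swap i j = Poly_Mapping.map_key (transpose i j)"

definition poly_swap :: "nat \<Rightarrow> nat \<Rightarrow> zpoly \<Rightarrow> zpoly" where
  "poly_swap i j = Poly_Mapping.map_key (monom_swap i j)"

lemma lookup_monom_swap [simp]:
  "Poly_Mapping.lookup (monom_swap i j m) k = Poly_Mapping.lookup m (transpose i j k)"
  by (simp add: monom_swap_def map_key.rep_eq)

lemma monom_swap_involutory [simp]: "monom_swap i j (monom_swap i j m) = m"
  by (rule poly_mapping_eqI) simp

lemma bij_monom_swap: "bij (monom_swap i j)"
  by (rule o_bij[of "monom_swap i j"]) (auto simp: fun_eq_iff)

lemma monom_swap_add: "monom_swap i j (m + n) = monom_swap i j m + monom_swap i j n"
  by (rule poly_mapping_eqI) (simp add: lookup_add)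

lemma lookup_poly_swap [simp]:
  "Poly_Mapping.lookup (poly_swap i j P) m = Poly_Mapping.lookup P (monom_swap i j m)"
  using bij_is_inj[OF bij_monom_swap] by (simp add: poly_swap_def map_key.rep_eq)

lemma poly_swap_involutory [simp]: "poly_swap i j (poly_swap i j P) = P"
  by (rule poly_mapping_eqI) simp

lemma poly_swap_add: "poly_swap i j (P + Q) = poly_swap i j P + poly_swap i j Q"
  by (rule poly_mapping_eqI) (simp add: lookup_add)

lemma poly_swap_zero [simp]: "poly_swap i j 0 = 0"
  by (rule poly_mapping_eqI) simp

lemma poly_swap_eq_0_iff [simp]: "poly_swap i j P = 0 \<longleftrightarrow> P = 0"
  by (metis poly_swap_involutory poly_swap_zero)

lemma Sum_any_monom_swap: "(\<Sum>m. h (monom_swap i j m)) = (\<Sum>m. h m)"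
  by (rule Sum_any.reindex_cong[OF bij_monom_swap, symmetric])
     (auto simp: fun_eq_iff)

lemma poly_swap_mult: "poly_swap i j (P * Q) = poly_swap i j P * poly_swap i j Q"
proof (rule poly_mapping_eqI)
  fix k
  let ?\<mu> = "monom_swap i j"
  have iff: "?\<mu> k = ?\<mu> l + ?\<mu> q \<longleftrightarrow> k = l + q" for l q
    by (metis monom_swap_add monom_swap_involutory)
  have "Poly_Mapping.lookup (poly_swap i j (P * Q)) k
      = (\<Sum>l. Poly_Mapping.lookup P l * (\<Sum>q. Poly_Mapping.lookup Q q when ?\<mu> k = l + q))"
    by (simp add: lookup_mult)
  \<comment> \<open>The permutation of monomials reindexes both sums of the convolution; by
    \<open>iff\<close> it then disappears from the condition.\<close>
  also have "\<dots> = (\<Sum>l. Poly_Mapping.lookup P (?\<mu> l) * (\<Sum>q. Poly_Mapping.lookup Q (?\<mu> q) when ?\<mu> k = ?\<mu> l + ?\<mu> q))"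
    by (subst Sum_any_monom_swap[of _ i j, symmetric], subst Sum_any_monom_swap[of _ i j, symmetric]) simp
  finally show "Poly_Mapping.lookup (poly_swap i j (P * Q)) k = Poly_Mapping.lookup (poly_swap i j P * poly_swap i j Q) k"
    by (simp add: lookup_mult iff)
qed

section \<open>Variables occurring in a polynomial\<close>

lemma finite_poly_vars [simp]: "finite (poly_vars P)"
  by (simp add: poly_vars_def)

lemma poly_vars_lookup: "i \<in> poly_vars P \<longleftrightarrow> (\<exists>m. Poly_Mapping.lookup P m \<noteq> 0 \<and> Poly_Mapping.lookup m i \<noteq> 0)"
  by (auto simp: poly_vars_def in_keys_iff)

lemma poly_vars_zero [simp]: "poly_vars 0 = {}"
  by (simp add: poly_vars_def)

lemma poly_vars_one [simp]: "poly_vars 1 = {}"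
  by (simp add: poly_vars_def)

lemma poly_vars_uminus [simp]: "poly_vars (- P) = poly_vars P"
  by (simp add: poly_vars_def)

lemma poly_vars_add: "poly_vars (P + Q) \<subseteq> poly_vars P \<union> poly_vars Q"
  using keys_add[of P Q] by (auto simp: poly_vars_def)

lemma poly_vars_mult: "poly_vars (P * Q) \<subseteq> poly_vars P \<union> poly_vars Q"
proof
  fix i assume "i \<in> poly_vars (P * Q)"
  then obtain m where m: "m \<in> Poly_Mapping.keys (P * Q)" "i \<in> Poly_Mapping.keys m"
    by (auto simp: poly_vars_def)
  then obtain a b where "m = a + b" "a \<in> Poly_Mapping.keys P" "b \<in> Poly_Mapping.keys Q"
    using keys_mult[of P Q] by auto
  then show "i \<in> poly_vars P \<union> poly_vars Q"
    using m(2) keys_add[of a b] by (auto simp: poly_vars_def)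
qed

lemma lead_monom_lookup_outside:
  assumes "P \<noteq> 0" "i \<notin> poly_vars P"
  shows "Poly_Mapping.lookup (lead_monom P) i = 0"
  using assms lead_coef_nonzero[OF assms(1)] by (auto simp: poly_vars_lookup lead_coef_def)

lemma poly_swap_fresh:
  assumes "i \<notin> poly_vars P" "j \<notin> poly_vars P"
  shows "poly_swap i j P = P"
proof (rule poly_mapping_eqI)
  fix m
  have fix_m: "monom_swap i j n = n" if "Poly_Mapping.lookup P n \<noteq> 0" for n
  proof (rule poly_mapping_eqI)
    fix k
    have "Poly_Mapping.lookup n i = 0" "Poly_Mapping.lookup n j = 0"
      using assms that by (auto simp: poly_vars_lookup)
    then show "Poly_Mapping.lookup (monom_swap i j n) k = Poly_Mapping.lookup n k"
      by (auto simp: transpose_def)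
  qed
  \<comment> \<open>If \<open>m\<close> or its image occurs in \<open>P\<close>, the two coincide;
    otherwise both coefficients vanish.\<close>
  show "Poly_Mapping.lookup (poly_swap i j P) m = Poly_Mapping.lookup P m"
    using fix_m[of m] fix_m[of "monom_swap i j m"]
    by (cases "Poly_Mapping.lookup P m = 0"; cases "Poly_Mapping.lookup P (monom_swap i j m) = 0") auto
qed

lemma poly_vars_poly_swap: "j \<notin> poly_vars P \<Longrightarrow> i \<notin> poly_vars (poly_swap i j P)"
  by (force simp: poly_vars_lookup)

section \<open>Transpositions as field automorphisms\<close>

lift_definition frac_swap :: "nat \<Rightarrow> nat \<Rightarrow> zfrac \<Rightarrow> zfrac" is
  "\<lambda>i j (P, Q). (poly_swap i j P, poly_swap i j Q)"
  by (auto simp flip: poly_swap_mult)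

lemma frac_swap_Fract: "Q \<noteq> 0 \<Longrightarrow> frac_swap i j (Fract P Q) = Fract (poly_swap i j P) (poly_swap i j Q)"
  by transfer simp

lemma poly_swap_one [simp]: "poly_swap i j 1 = 1"
  by (rule poly_swap_fresh) auto

lemma poly_swap_uminus: "poly_swap i j (- P) = - poly_swap i j P"
  by (rule poly_mapping_eqI) simp

lemma frac_swap_zero [simp]: "frac_swap i j 0 = 0"
  by (simp add: Zero_fract_def frac_swap_Fract)

lemma frac_swap_one [simp]: "frac_swap i j 1 = 1"
  by (simp add: One_fract_def frac_swap_Fract)

lemma frac_swap_add: "frac_swap i j (f + g) = frac_swap i j f + frac_swap i j g"
  by (cases f, cases g) (simp add: frac_swap_Fract poly_swap_add poly_swap_mult)

lemma frac_swap_mult: "frac_swap i j (f * g) = frac_swap i j f * frac_swap i j g"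
  by (cases f, cases g) (simp add: frac_swap_Fract poly_swap_mult)

lemma frac_swap_uminus: "frac_swap i j (- f) = - frac_swap i j f"
  by (cases f) (simp add: frac_swap_Fract poly_swap_uminus)

lemma frac_swap_involutory [simp]: "frac_swap i j (frac_swap i j f) = f"
  by (cases f) (simp add: frac_swap_Fract)

lemma frac_swap_eq_0_iff [simp]: "frac_swap i j f = 0 \<longleftrightarrow> f = 0"
  by (metis frac_swap_involutory frac_swap_zero)

lemma frac_swap_inverse: "frac_swap i j (inverse f) = inverse (frac_swap i j f)"
proof (cases "f = 0")
  case False
  have "frac_swap i j (inverse f) * frac_swap i j f = 1"
    using False by (simp flip: frac_swap_mult)
  then show ?thesis by (metis inverse_unique mult.commute)
qed simp

lemma frac_swap_commute: "frac_swap i j f = frac_swap j i f"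
  by (cases f) (simp add: frac_swap_Fract poly_swap_def monom_swap_def transpose_commute)

lemma frac_swap_same [simp]: "frac_swap i i f = f"
proof -
  have "monom_swap i i m = m" for m by (rule poly_mapping_eqI) simp
  then have "poly_swap i i P = P" for P by (intro poly_mapping_eqI) simp
  then show ?thesis by (cases f) (simp add: frac_swap_Fract)
qed

lemma frac_swap_swap:
  assumes "{i, j} \<inter> {k, l} = {}"
  shows "frac_swap i j (frac_swap k l f) = frac_swap k l (frac_swap i j f)"
proof -
  have "monom_swap k l (monom_swap i j m) = monom_swap i j (monom_swap k l m)" for m
    using assms by (intro poly_mapping_eqI) (auto simp: transpose_def)
  then have "poly_swap i j (poly_swap k l P) = poly_swap k l (poly_swap i j P)" for P
    by (intro poly_mapping_eqI) simp
  then show ?thesis by (cases f) (simp add: frac_swap_Fract)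
qed

text \<open>Conjugation of transpositions; it turns invariance under two transpositions into
  invariance under a third.\<close>

lemma frac_swap_triple:
  assumes "i \<noteq> k" "j \<noteq> k"
  shows "frac_swap i j (frac_swap j k (frac_swap i j f)) = frac_swap i k f"
proof -
  have "monom_swap i j (monom_swap j k (monom_swap i j m)) = monom_swap i k m" for m
    using transpose_triple[OF assms] by (intro poly_mapping_eqI) simp
  then have "poly_swap i j (poly_swap j k (poly_swap i j P)) = poly_swap i k P" for P
    by (intro poly_mapping_eqI) simp
  then show ?thesis by (cases f) (simp add: frac_swap_Fract)
qed

subsection \<open>Support\<close>

text \<open>The support in the sense of nominal sets. Unlike \<open>Var\<close> it refers to no
  representation, so its behaviour under the field operations follows from that of
  \<open>frac_swap\<close>.\<close>

definition supp :: "zfrac \<Rightarrow> nat set" where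
  "supp f = {i. infinite {j. frac_swap i j f \<noteq> f}}"

lemma supp_Fract:
  assumes "Q \<noteq> 0"
  shows "supp (Fract P Q) \<subseteq> poly_vars P \<union> poly_vars Q"
proof
  fix i assume i: "i \<in> supp (Fract P Q)"
  show "i \<in> poly_vars P \<union> poly_vars Q"
  proof (rule ccontr)
    assume n: "i \<notin> poly_vars P \<union> poly_vars Q"
    have "frac_swap i j (Fract P Q) = Fract P Q" if "j \<notin> poly_vars P \<union> poly_vars Q" for j
      using n assms that by (simp add: frac_swap_Fract poly_swap_fresh)
    then have "{j. frac_swap i j (Fract P Q) \<noteq> Fract P Q} \<subseteq> poly_vars P \<union> poly_vars Q"
      by blast
    then have "finite {j. frac_swap i j (Fract P Q) \<noteq> Fract P Q}"
      by (rule finite_subset) simp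
    then show False using i by (simp add: supp_def)
  qed
qed

lemma finite_supp [simp]: "finite (supp f)"
proof (cases f)
  case (Fract P Q)
  then show ?thesis using finite_subset[OF supp_Fract[of Q P]] by simp
qed

text \<open>Through this inclusion disjointness of \<open>Var\<close> passes to
  \<open>supp\<close>.\<close>

lemma supp_subset_Var: "supp f \<subseteq> Var f"
proof -
  obtain P Q where "Q \<noteq> 0" "zpoly_coprime P Q" "f = Fract P Q"
    using canonical_rep_exists by blast
  then show ?thesis using supp_Fract[of Q P] by (auto simp: Var_def)
qed

text \<open>Exchanging \<open>i\<close> or \<open>j\<close> with almost every \<open>k\<close> fixes
  \<open>f\<close>. For a common such \<open>k\<close>, the transposition of \<open>i\<close> and
  \<open>j\<close> is composed of these two.\<close>

lemma frac_swap_fresh: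
  assumes "i \<notin> supp f" "j \<notin> supp f"
  shows "frac_swap i j f = f"
proof (cases "i = j")
  case True
  then show ?thesis by simp
next
  case False
  have "finite ({k. frac_swap i k f \<noteq> f} \<union> {k. frac_swap j k f \<noteq> f} \<union> {i, j})" (is "finite ?A")
    using assms by (simp add: supp_def)
  then obtain k where "k \<notin> ?A"
    using ex_new_if_finite[OF infinite_UNIV_nat, of ?A] by auto
  then have k: "frac_swap i k f = f" "frac_swap j k f = f" "k \<noteq> i" "k \<noteq> j"
    by auto
  have "frac_swap i j f = frac_swap i k (frac_swap k j (frac_swap i k f))"
    using False k(3,4) by (intro frac_swap_triple[symmetric]) auto
  then show ?thesis using k by (simp add: frac_swap_commute[of k j f])
qed

lemma notin_suppI:
  assumes "\<And>j. j \<notin> A \<Longrightarrow> frac_swap i j f = f" "finite A"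
  shows "i \<notin> supp f"
proof -
  have "{j. frac_swap i j f \<noteq> f} \<subseteq> A" using assms(1) by blast
  then show ?thesis using assms(2) finite_subset by (auto simp: supp_def)
qed

text \<open>If \<open>f\<close> were fixed, composing with exchanges of \<open>v\<close> and
  \<open>k\<close> would show that exchanging \<open>u\<close> with almost every \<open>k\<close>
  fixes \<open>f\<close>, against \<open>u \<in> supp f\<close>.\<close>

lemma frac_swap_moves:
  assumes "u \<in> supp f" "v \<notin> supp f"
  shows "frac_swap u v f \<noteq> f"
proof
  assume eq: "frac_swap u v f = f"
  have "frac_swap u k f = f" if "k \<notin> supp f \<union> {u, v}" for k
  proof -
    have "frac_swap v k f = f" using assms that by (intro frac_swap_fresh) auto
    then show ?thesis using frac_swap_triple[of u k v f] that eq by simp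
  qed
  then have "u \<notin> supp f" by (intro notin_suppI[of "supp f \<union> {u, v}"]) auto
  then show False using assms(1) by blast
qed

lemma supp_zero [simp]: "supp 0 = {}"
  by (simp add: supp_def)

lemma supp_one [simp]: "supp 1 = {}"
  by (simp add: supp_def)

lemma supp_uminus [simp]: "supp (- f) = supp f"
  by (simp add: supp_def frac_swap_uminus)

lemma supp_inverse [simp]: "supp (inverse f) = supp f"
  by (simp add: supp_def frac_swap_inverse)

lemma supp_add: "supp (f + g) \<subseteq> supp f \<union> supp g"
proof
  fix i assume i: "i \<in> supp (f + g)"
  show "i \<in> supp f \<union> supp g"
  proof (rule ccontr)
    assume "i \<notin> supp f \<union> supp g"
    then have "i \<notin> supp (f + g)"
      by (intro notin_suppI[of "supp f \<union> supp g"]) (auto simp: frac_swap_add frac_swap_fresh)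
    then show False using i by blast
  qed
qed

lemma supp_mult: "supp (f * g) \<subseteq> supp f \<union> supp g"
proof
  fix i assume i: "i \<in> supp (f * g)"
  show "i \<in> supp f \<union> supp g"
  proof (rule ccontr)
    assume "i \<notin> supp f \<union> supp g"
    then have "i \<notin> supp (f * g)"
      by (intro notin_suppI[of "supp f \<union> supp g"]) (auto simp: frac_swap_mult frac_swap_fresh)
    then show False using i by blast
  qed
qed

lemma supp_sum: "supp (\<Sum>x\<in>I. f x) \<subseteq> (\<Union>x\<in>I. supp (f x))"
proof (induction I rule: infinite_finite_induct)
  case (insert x I)
  then show ?case using supp_add[of "f x" "\<Sum>x\<in>I. f x"] by auto
qed auto

lemma supp_prod: "supp (\<Prod>x\<in>I. f x) \<subseteq> (\<Union>x\<in>I. supp (f x))"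
proof (induction I rule: infinite_finite_induct)
  case (insert x I)
  then show ?case using supp_mult[of "f x" "\<Prod>x\<in>I. f x"] by auto
qed auto

text \<open>No variable cancels: each summand is the total minus the other summands, which do not
  involve its variables.\<close>

lemma supp_sum_disjoint:
  assumes "finite I" "disjoint_family_on (\<lambda>x. supp (f x)) I"
  shows "supp (\<Sum>x\<in>I. f x) = (\<Union>x\<in>I. supp (f x))"
proof
  show "(\<Union>x\<in>I. supp (f x)) \<subseteq> supp (\<Sum>x\<in>I. f x)"
  proof
    fix u assume "u \<in> (\<Union>x\<in>I. supp (f x))"
    then obtain y where y: "y \<in> I" "u \<in> supp (f y)" by blast
    have "f y = (\<Sum>x\<in>I. f x) + - (\<Sum>x\<in>I - {y}. f x)"
      by (simp add: sum.remove[OF assms(1) y(1)])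
    then have "u \<in> supp (\<Sum>x\<in>I. f x) \<union> (\<Union>x\<in>I - {y}. supp (f x))"
      using y supp_add[of "\<Sum>x\<in>I. f x" "- (\<Sum>x\<in>I - {y}. f x)"] supp_sum[of f "I - {y}"] by auto
    moreover have "u \<notin> (\<Union>x\<in>I - {y}. supp (f x))"
      using y assms(2) by (auto simp: disjoint_family_on_def)
    ultimately show "u \<in> supp (\<Sum>x\<in>I. f x)" by blast
  qed
qed (rule supp_sum)

text \<open>As for sums, now dividing by the other factors, which must therefore be nonzero.\<close>

lemma supp_prod_disjoint:
  assumes "finite I" "disjoint_family_on (\<lambda>x. supp (f x)) I" "\<And>x. x \<in> I \<Longrightarrow> f x \<noteq> 0"
  shows "supp (\<Prod>x\<in>I. f x) = (\<Union>x\<in>I. supp (f x))"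
proof
  show "(\<Union>x\<in>I. supp (f x)) \<subseteq> supp (\<Prod>x\<in>I. f x)"
  proof
    fix u assume "u \<in> (\<Union>x\<in>I. supp (f x))"
    then obtain y where y: "y \<in> I" "u \<in> supp (f y)" by blast
    have "f y = (\<Prod>x\<in>I. f x) * inverse (\<Prod>x\<in>I - {y}. f x)"
      using y assms(1,3) by (simp add: prod.remove[OF assms(1) y(1)] mult.assoc)
    then have "u \<in> supp (\<Prod>x\<in>I. f x) \<union> (\<Union>x\<in>I - {y}. supp (f x))"
      using y supp_mult[of "\<Prod>x\<in>I. f x" "inverse (\<Prod>x\<in>I - {y}. f x)"] supp_prod[of f "I - {y}"] by auto
    moreover have "u \<notin> (\<Union>x\<in>I - {y}. supp (f x))"
      using y assms(2) by (auto simp: disjoint_family_on_def)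
    ultimately show "u \<in> supp (\<Prod>x\<in>I. f x)" by blast
  qed
qed (rule supp_prod)

lemma zvar_nonzero [simp]: "zvar i \<noteq> 0"
  by (simp add: zvar_def Zero_fract_def eq_fract)

lemma supp_zvar [simp]: "supp (zvar i) = {i}"
proof
  show "supp (zvar i) \<subseteq> {i}"
    using supp_Fract[of 1 "Poly_Mapping.single (Poly_Mapping.single i 1) 1"]
    by (simp add: zvar_def poly_vars_def)
  have "frac_swap i j (zvar i) \<noteq> zvar i" if "j \<noteq> i" for j
  proof -
    have "monom_swap i j (Poly_Mapping.single i 1) \<noteq> Poly_Mapping.single i (1::nat)"
      using that by (auto simp: poly_mapping_eq_iff fun_eq_iff lookup_single transpose_def intro!: exI[of _ i])
    then have "poly_swap i j (Poly_Mapping.single (Poly_Mapping.single i 1) 1) \<noteq> Poly_Mapping.single (Poly_Mapping.single i 1) 1"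
      by (metis lookup_poly_swap lookup_single_eq lookup_single_not_eq zero_neq_one)
    then show ?thesis by (simp add: zvar_def frac_swap_Fract eq_fract)
  qed
  then have "{j. frac_swap i j (zvar i) \<noteq> zvar i} = UNIV - {i}" by auto
  then show "{i} \<subseteq> supp (zvar i)" by (simp add: supp_def)
qed

text \<open>At each variable, compare the exponents on both sides of the equation that says that a
  fresh transposition fixes the fraction.\<close>

lemma lead_monom_eq_of_supp_empty:
  assumes "P \<noteq> 0" "Q \<noteq> 0" "supp (Fract P Q) = {}"
  shows "lead_monom P = lead_monom Q"
proof (rule poly_mapping_eqI)
  fix i
  obtain j where j: "j \<notin> poly_vars P \<union> poly_vars Q"
    using ex_new_if_finite[OF infinite_UNIV_nat, of "poly_vars P \<union> poly_vars Q"] by auto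
  have nz: "poly_swap i j P \<noteq> 0" "poly_swap i j Q \<noteq> 0" using assms by auto
  have "frac_swap i j (Fract P Q) = Fract P Q" using assms by (intro frac_swap_fresh) auto
  then have "poly_swap i j P * Q = P * poly_swap i j Q"
    using assms by (simp add: frac_swap_Fract eq_fract)
  then have "lead_monom (poly_swap i j P) + lead_monom Q = lead_monom P + lead_monom (poly_swap i j Q)"
    using assms nz by (metis lead_monom_mult)
  then have "Poly_Mapping.lookup (lead_monom (poly_swap i j P)) i + Poly_Mapping.lookup (lead_monom Q) i
      = Poly_Mapping.lookup (lead_monom P) i + Poly_Mapping.lookup (lead_monom (poly_swap i j Q)) i"
    by (metis lookup_add)
  then show "Poly_Mapping.lookup (lead_monom P) i = Poly_Mapping.lookup (lead_monom Q) i"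
    using j nz lead_monom_lookup_outside poly_vars_poly_swap by simp
qed

text \<open>Up to the sign of \<open>P\<close> the leading coefficients agree. If
  \<open>P \<noteq> Q\<close>, then \<open>P / Q - 1\<close> has empty support too, so
  \<open>P - Q\<close> has the leading monomial of \<open>Q\<close>; but there the coefficients of
  \<open>P\<close> and \<open>Q\<close> cancel.\<close>

lemma supp_empty_unit:
  assumes "P \<noteq> 0" "Q \<noteq> 0" "supp (Fract P Q) = {}" "\<bar>lead_coef P\<bar> = \<bar>lead_coef Q\<bar>"
  shows "Fract P Q = 1 \<or> Fract P Q = - 1"
proof -
  have key: "P = Q" if P: "P \<noteq> 0" "supp (Fract P Q) = {}" "lead_coef P = lead_coef Q" for P
  proof (rule ccontr)
    assume "P \<noteq> Q"
    then have nz: "P - Q \<noteq> 0" by simp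
    have lm: "lead_monom P = lead_monom Q"
      using P assms(2) by (intro lead_monom_eq_of_supp_empty)
    have "Fract (P - Q) Q = Fract P Q + - 1"
      using assms(2) by (simp add: One_fract_def eq_fract)
    then have "supp (Fract (P - Q) Q) = {}"
      using supp_add[of "Fract P Q" "- 1"] P by simp
    then have "lead_monom (P - Q) = lead_monom Q"
      using nz assms(2) by (intro lead_monom_eq_of_supp_empty)
    then have "lead_coef (P - Q) = lead_coef P - lead_coef Q"
      using lm by (simp add: lead_coef_def lookup_minus)
    then show False using lead_coef_nonzero[OF nz] P by simp
  qed
  consider "lead_coef P = lead_coef Q" | "lead_coef (- P) = lead_coef Q"
    using assms(4) by (auto simp: abs_if split: if_splits)
  then show ?thesis
  proof cases
    case 1
    then have "P = Q" using assms by (intro key)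
    then show ?thesis using assms by (simp add: One_fract_def eq_fract)
  next
    case 2
    have "supp (Fract (- P) Q) = {}" using assms(3) by (metis minus_fract supp_uminus)
    then have "- P = Q" using assms 2 by (intro key) auto
    then show ?thesis using assms by (auto simp: One_fract_def eq_fract)
  qed
qed

subsection \<open>Additive and multiplicative separation of variables\<close>

text \<open>Vanishing of the mixed second difference of \<open>f\<close> in \<open>u\<close> and
  \<open>w\<close>, where exchange with \<open>u'\<close> and \<open>w'\<close> replaces an
  increment. \<open>mul_sep\<close> is the multiplicative analogue.\<close>

definition add_sep :: "nat \<Rightarrow> nat \<Rightarrow> nat \<Rightarrow> nat \<Rightarrow> zfrac \<Rightarrow> bool" where
  "add_sep u u' w w' f \<longleftrightarrow>
     f + frac_swap u u' (frac_swap w w' f) = frac_swap u u' f + frac_swap w w' f"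

definition mul_sep :: "nat \<Rightarrow> nat \<Rightarrow> nat \<Rightarrow> nat \<Rightarrow> zfrac \<Rightarrow> bool" where
  "mul_sep u u' w w' f \<longleftrightarrow>
     f * frac_swap u u' (frac_swap w w' f) = frac_swap u u' f * frac_swap w w' f"

text \<open>One of the two transpositions fixes \<open>f\<close>; as they commute, it can be applied
  first, and the two sides have the same terms.\<close>

lemma add_sep_fresh:
  assumes "{u, u'} \<inter> {w, w'} = {}" "{u, u'} \<inter> supp f = {} \<or> {w, w'} \<inter> supp f = {}"
  shows "add_sep u u' w w' f"
  using assms(2) frac_swap_swap[OF assms(1), of f] by (auto simp: add_sep_def frac_swap_fresh)

lemma mul_sep_fresh:
  assumes "{u, u'} \<inter> {w, w'} = {}" "{u, u'} \<inter> supp f = {} \<or> {w, w'} \<inter> supp f = {}"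
  shows "mul_sep u u' w w' f"
  using assms(2) frac_swap_swap[OF assms(1), of f] by (auto simp: mul_sep_def frac_swap_fresh mult.commute)

lemma add_sep_add:
  assumes "add_sep u u' w w' f" "add_sep u u' w w' g"
  shows "add_sep u u' w w' (f + g)"
proof -
  let ?s = "frac_swap u u'" and ?t = "frac_swap w w'"
  have "(f + g) + (?s (?t f) + ?s (?t g)) = (f + ?s (?t f)) + (g + ?s (?t g))"
    by (simp add: ac_simps)
  also have "\<dots> = (?s f + ?t f) + (?s g + ?t g)"
    using assms by (simp add: add_sep_def)
  also have "\<dots> = (?s f + ?s g) + (?t f + ?t g)"
    by (simp add: ac_simps)
  finally show ?thesis by (simp add: add_sep_def frac_swap_add)
qed

lemma mul_sep_mult:
  assumes "mul_sep u u' w w' f" "mul_sep u u' w w' g"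
  shows "mul_sep u u' w w' (f * g)"
proof -
  let ?s = "frac_swap u u'" and ?t = "frac_swap w w'"
  have "(f * g) * (?s (?t f) * ?s (?t g)) = (f * ?s (?t f)) * (g * ?s (?t g))"
    by (simp add: ac_simps)
  also have "\<dots> = (?s f * ?t f) * (?s g * ?t g)"
    using assms by (simp add: mul_sep_def)
  also have "\<dots> = (?s f * ?s g) * (?t f * ?t g)"
    by (simp add: ac_simps)
  finally show ?thesis by (simp add: mul_sep_def frac_swap_mult)
qed

lemma mul_sep_inverse_iff: "mul_sep u u' w w' (inverse f) \<longleftrightarrow> mul_sep u u' w w' f"
  unfolding mul_sep_def frac_swap_inverse by (simp flip: inverse_mult_distrib)

lemma add_sep_sum: "(\<And>x. x \<in> I \<Longrightarrow> add_sep u u' w w' (f x)) \<Longrightarrow> add_sep u u' w w' (\<Sum>x\<in>I. f x)"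
  by (induction I rule: infinite_finite_induct) (auto intro: add_sep_add, auto simp: add_sep_def)

lemma mul_sep_prod: "(\<And>x. x \<in> I \<Longrightarrow> mul_sep u u' w w' (f x)) \<Longrightarrow> mul_sep u u' w w' (\<Prod>x\<in>I. f x)"
  by (induction I rule: infinite_finite_induct) (auto intro: mul_sep_mult, auto simp: mul_sep_def)

section \<open>Incompatibility of the separation relations\<close>

lemma not_add_sep_and_mul_sep:
  assumes "u \<in> supp f" "w \<in> supp f" "u' \<notin> supp f" "w' \<notin> supp f"
    and "add_sep u u' w w' f"
  shows "\<not> mul_sep u u' w w' f"
proof
  assume m: "mul_sep u u' w w' f"
  let ?s = "frac_swap u u' f" and ?t = "frac_swap w w' f" and ?st = "frac_swap u u' (frac_swap w w' f)"
  have st: "?st = ?s + ?t - f"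
    using assms(5) by (simp add: add_sep_def eq_diff_eq add.commute)
  have "(f - ?s) * (f - ?t) = ?s * ?t - f * ?st"
    unfolding st by (simp add: algebra_simps)
  then have "(f - ?s) * (f - ?t) = 0"
    using m by (simp add: mul_sep_def)
  \<comment> \<open>Neither factor vanishes, since each exchanges a variable of the support with one
    outside it.\<close>
  then show False
    using frac_swap_moves[OF assms(1,3)] frac_swap_moves[OF assms(2,4)] by auto
qed

text \<open>Otherwise exchanging \<open>u, u'\<close> in \<open>f\<close> gives the negative of
  exchanging \<open>w, w'\<close>, which for a fresh \<open>v\<close> is invariant under exchanging
  \<open>u', v\<close>. Conjugating back, \<open>f\<close> is invariant under exchanging
  \<open>u, v\<close>, although \<open>u\<close> lies in its support.\<close>

lemma neg_frac_swap_frac_swap_ne: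
  assumes "u \<in> supp f" "w \<in> supp f" "u' \<notin> supp f" "w' \<notin> supp f" "u' \<noteq> w'" "u \<noteq> w"
  shows "f \<noteq> - frac_swap u u' (frac_swap w w' f)"
proof
  assume f: "f = - frac_swap u u' (frac_swap w w' f)"
  obtain v where v: "v \<notin> supp f \<union> {u', w'}"
    using ex_new_if_finite[OF infinite_UNIV_nat, of "supp f \<union> {u', w'}"] by auto
  have ne: "v \<noteq> u" "v \<noteq> w" "u' \<noteq> u" "u' \<noteq> w" "w' \<noteq> u" "w' \<noteq> w" using assms v by auto
  let ?t = "frac_swap w w' f"
  have s1: "frac_swap u u' f = - ?t"
    by (subst f) (simp add: frac_swap_uminus)
  have fix_f: "frac_swap u' v f = f" using assms v by (intro frac_swap_fresh) auto
  have "{u', v} \<inter> {w, w'} = {}" using v ne assms by auto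
  then have "frac_swap u' v ?t = ?t"
    using frac_swap_swap[of u' v w w' f] fix_f by simp
  then have "frac_swap u' v (frac_swap u u' f) = frac_swap u u' f"
    unfolding s1 by (simp add: frac_swap_uminus)
  then have "frac_swap u u' (frac_swap u' v (frac_swap u u' f)) = f" by simp
  then have "frac_swap u v f = f"
    using frac_swap_triple[of u v u' f] v ne by simp
  then show False using frac_swap_moves[of u f v] assms v by simp
qed

text \<open>Write \<open>a, b, d, e\<close> for the four images of \<open>f\<close>. The two
  relations read \<open>a + e = b + d\<close> and \<open>c/a + c/e = c/b + c/d\<close>, whence
  \<open>(b + d) * (b * d - a * e) = 0\<close>. The first factor is nonzero by the preceding lemma,
  so \<open>f\<close> is also multiplicatively separated, a contradiction.\<close>

lemma not_add_sep_and_add_sep_quotient: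
  assumes "u \<in> supp f" "w \<in> supp f" "u' \<notin> supp f" "w' \<notin> supp f" "u' \<noteq> w'" "u \<noteq> w"
    and "add_sep u u' w w' f" "f * g = c" "supp c = {}" "c \<noteq> 0"
  shows "\<not> add_sep u u' w w' g"
proof
  assume g: "add_sep u u' w w' g"
  define a b d e where "a = f" and "b = frac_swap u u' f" and "d = frac_swap w w' f"
    and "e = frac_swap u u' (frac_swap w w' f)"
  define a' b' d' e' where "a' = g" and "b' = frac_swap u u' g" and "d' = frac_swap w w' g"
    and "e' = frac_swap u u' (frac_swap w w' g)"
  have c: "frac_swap i j c = c" for i j using assms(9) by (simp add: frac_swap_fresh)
  have prods: "a * a' = c" "b * b' = c" "d * d' = c" "e * e' = c"
    using c assms(8) unfolding a_def b_def d_def e_def a'_def b'_def d'_def e'_def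
    by (simp_all flip: frac_swap_mult)
  then have nz: "a \<noteq> 0" "b \<noteq> 0" "d \<noteq> 0" "e \<noteq> 0" using assms(10) by auto
  have inv: "a' = c / a" "b' = c / b" "d' = c / d" "e' = c / e"
    using prods nz by (auto simp: field_simps)
  have sum: "a + e = b + d" using assms(7) by (simp add: add_sep_def a_def b_def d_def e_def)
  have sum': "a' + e' = b' + d'" using g by (simp add: add_sep_def a'_def b'_def d'_def e'_def)
  have "c * (a + e) = (a' + e') * (a * e)" "c * (b + d) = (b' + d') * (b * d)"
    unfolding inv using nz by (simp_all add: field_simps)
  then have "c * (a + e) * (b * d) = c * (b + d) * (a * e)"
    using sum' by (simp add: ac_simps)
  then have eq: "c * (b + d) * (b * d) = c * (b + d) * (a * e)" unfolding sum .
  have "c * ((b + d) * (b * d - a * e)) = c * (b + d) * (b * d) - c * (b + d) * (a * e)"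
    by (simp add: algebra_simps)
  then have "(b + d) * (b * d - a * e) = 0"
    using assms(10) by (simp only: eq) simp
  moreover have "b + d \<noteq> 0" unfolding sum[symmetric]
    using neg_frac_swap_frac_swap_ne[OF assms(1-6)] by (simp add: a_def e_def add_eq_0_iff2)
  ultimately have "mul_sep u u' w w' f"
    by (simp add: mul_sep_def a_def b_def d_def e_def)
  then show False using not_add_sep_and_mul_sep assms by blast
qed

text \<open>\<open>b\<close> labels each variable by the summand containing it. Only this trace of a
  decomposition into at least two summands enters the later arguments.\<close>

definition sum_blocks :: "(nat \<Rightarrow> nat) \<Rightarrow> zfrac \<Rightarrow> bool" where
  "sum_blocks b f \<longleftrightarrow> (\<exists>u\<in>supp f. \<exists>w\<in>supp f. b u \<noteq> b w) \<and>
     (\<forall>u\<in>supp f. \<forall>w\<in>supp f. \<forall>u' w'. b u \<noteq> b w \<longrightarrow> u' \<notin> supp f \<longrightarrow> w' \<notin> supp f \<longrightarrow> u' \<noteq> w' \<longrightarrow>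
        add_sep u u' w w' f)"

text \<open>Two partitions: if \<open>c\<close> does not separate \<open>u, w\<close>, then one of
  \<open>u', w'\<close> has a \<open>c\<close>-value different from theirs, and its
  \<open>b\<close>-value differs from that of \<open>u\<close> or of \<open>w\<close>.\<close>

lemma common_separation:
  assumes "u \<in> S" "w \<in> S" "b u \<noteq> b w" "u' \<in> S" "w' \<in> S" "c u' \<noteq> c w'"
  shows "\<exists>x\<in>S. \<exists>y\<in>S. b x \<noteq> b y \<and> c x \<noteq> c y"
  using assms by metis

lemma sum_blocks_sum:
  fixes f :: "nat \<Rightarrow> zfrac"
  assumes "finite I" "disjoint_family_on (\<lambda>i. supp (f i)) I"
    and "x \<in> I" "y \<in> I" "x \<noteq> y" "supp (f x) \<noteq> {}" "supp (f y) \<noteq> {}"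
  shows "\<exists>b. sum_blocks b (\<Sum>i\<in>I. f i)"
proof -
  \<comment> \<open>Disjointness makes the index unique for variables of the sum; elsewhere the
    value is arbitrary.\<close>
  define b where "b u = (SOME i. i \<in> I \<and> u \<in> supp (f i))" for u
  have supp: "supp (\<Sum>i\<in>I. f i) = (\<Union>i\<in>I. supp (f i))"
    using assms by (intro supp_sum_disjoint)
  have b: "b u = i" if "i \<in> I" "u \<in> supp (f i)" for u i
    unfolding b_def using that assms(2) by (intro some_equality) (auto simp: disjoint_family_on_def)
  have "\<exists>u\<in>supp (\<Sum>i\<in>I. f i). \<exists>w\<in>supp (\<Sum>i\<in>I. f i). b u \<noteq> b w"
  proof -
    obtain u w where "u \<in> supp (f x)" "w \<in> supp (f y)" using assms by blast
    then have "u \<in> supp (\<Sum>i\<in>I. f i)" "w \<in> supp (\<Sum>i\<in>I. f i)" "b u \<noteq> b w"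
      using b assms(3-5) by (auto simp: supp)
    then show ?thesis by blast
  qed
  moreover have "add_sep u u' w w' (\<Sum>i\<in>I. f i)"
    if u: "u \<in> supp (\<Sum>i\<in>I. f i)" "w \<in> supp (\<Sum>i\<in>I. f i)" "b u \<noteq> b w"
      and u': "u' \<notin> supp (\<Sum>i\<in>I. f i)" "w' \<notin> supp (\<Sum>i\<in>I. f i)" "u' \<noteq> w'" for u w u' w'
  proof (intro add_sep_sum add_sep_fresh)
    show "{u, u'} \<inter> {w, w'} = {}" using u u' by auto
    show "{u, u'} \<inter> supp (f i) = {} \<or> {w, w'} \<inter> supp (f i) = {}" if "i \<in> I" for i
      using u u' that b[OF that] unfolding supp by auto
  qed
  ultimately show ?thesis unfolding sum_blocks_def by blast
qed

text \<open>A signed variable has a single block and is therefore a separate case.\<close>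

definition sum_like :: "zfrac \<Rightarrow> bool" where
  "sum_like f \<longleftrightarrow> (\<exists>i. f = zvar i \<or> f = - zvar i) \<or> (\<exists>b. sum_blocks b f)"

lemma sum_like_supp_nonempty: "sum_like f \<Longrightarrow> supp f \<noteq> {}"
  by (auto simp: sum_like_def sum_blocks_def)

lemma sum_like_nonzero: "sum_like f \<Longrightarrow> f \<noteq> 0"
  using sum_like_supp_nonempty by fastforce

lemma disjoint_supp: "disjoint_family_on (\<lambda>i. Var (f i)) I \<Longrightarrow> disjoint_family_on (\<lambda>i. supp (f i)) I"
  using supp_subset_Var by (fastforce simp: disjoint_family_on_def)

text \<open>A variable of the first operand survives: disjointness rules out cancellation within the
  sum or the numerator and keeps the variable out of the denominator.\<close>

lemma expr_supp_nonempty: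
  "sum_type k f \<Longrightarrow> supp f \<noteq> {}"
  "prod_type k f \<Longrightarrow> supp f \<noteq> {}"
proof (induction rule: sum_type_prod_type.inducts)
  case (sum s f k)
  have "supp (\<Sum>i=1..s. f i) = (\<Union>i\<in>{1..s}. supp (f i))"
    using sum by (intro supp_sum_disjoint disjoint_supp) auto
  moreover have "supp (f 1) \<noteq> {}" "1 \<in> {1..s}" using sum by auto
  ultimately show ?case by blast
next
  case (prod s t f k g)
  let ?F = "\<Prod>i=1..s. f i" and ?G = "\<Prod>j=1..t. g j"
  have 1: "1 \<in> {1..s}" using prod by auto
  then obtain u where u: "u \<in> supp (f 1)" using prod by blast
  have "supp ?F = (\<Union>i\<in>{1..s}. supp (f i))"
    using prod by (intro supp_prod_disjoint disjoint_supp) (auto simp: vars_disjoint_def)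
  then have "u \<in> supp ?F" using u 1 by blast
  moreover have "u \<notin> supp ?G"
  proof
    assume "u \<in> supp ?G"
    then obtain j where j: "j \<in> {1..t}" "u \<in> supp (g j)" using supp_prod by blast
    then have "u \<in> Var (f 1) \<inter> Var (g j)" using u supp_subset_Var by blast
    moreover have "Var (f 1) \<inter> Var (g j) = {}"
      using \<open>vars_disjoint s f t g\<close> 1 j unfolding vars_disjoint_def by blast
    ultimately show False by blast
  qed
  moreover have "?F = ?F / ?G * ?G" using prod by simp
  then have "supp ?F \<subseteq> supp (?F / ?G) \<union> supp ?G" using supp_mult by metis
  ultimately show ?case by blast
qed auto

lemma sum_type_sum_like:
  assumes "sum_type k f"
  shows "sum_like f"
  using assms
proof cases
  case (sum s f k')
  have ne: "supp (f i) \<noteq> {}" if i: "i \<in> {1..s}" for i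
  proof -
    obtain l where "prod_type l (f i)"
      using \<open>\<forall>i\<in>{1..s}. f i \<noteq> 0 \<and> (\<exists>l\<le>k'. prod_type l (f i))\<close> i by blast
    then show ?thesis by (rule expr_supp_nonempty)
  qed
  have "\<exists>b. sum_blocks b (\<Sum>i=1..s. f i)"
  proof (rule sum_blocks_sum)
    show "(1::nat) \<in> {1..s}" "(2::nat) \<in> {1..s}" using \<open>s \<ge> 2\<close> by auto
    then show "supp (f 1) \<noteq> {}" "supp (f 2) \<noteq> {}" using ne by blast+
    show "disjoint_family_on (\<lambda>i. supp (f i)) {1..s}"
      using \<open>disjoint_family_on (\<lambda>i. Var (f i)) {1..s}\<close> by (rule disjoint_supp)
  qed auto
  then show ?thesis using sum by (auto simp: sum_like_def)
qed (auto simp: sum_like_def)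

subsection \<open>Factorizations in disjoint variables\<close>

text \<open>Connectedness of a graph on \<open>supp f\<close>, stated by cuts: \<open>u\<close> and
  \<open>w\<close> are joined if no distinct fresh variables separate them multiplicatively, and
  every proper cut \<open>U\<close> is crossed by an edge.\<close>

definition connected :: "zfrac \<Rightarrow> bool" where
  "connected f \<longleftrightarrow> f \<noteq> 0 \<and> supp f \<noteq> {} \<and> (\<forall>U. supp f \<inter> U \<noteq> {} \<longrightarrow> \<not> supp f \<subseteq> U \<longrightarrow>
     (\<exists>u\<in>supp f. \<exists>w\<in>supp f. (u \<in> U) \<noteq> (w \<in> U) \<and>
       (\<forall>u' w'. u' \<notin> supp f \<longrightarrow> w' \<notin> supp f \<longrightarrow> u' \<noteq> w' \<longrightarrow> \<not> mul_sep u u' w w' f)))"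

lemma connectedE:
  assumes "connected f" "supp f \<inter> U \<noteq> {}" "\<not> supp f \<subseteq> U"
  obtains u w where "u \<in> supp f" "w \<in> supp f" "(u \<in> U) \<noteq> (w \<in> U)"
    "\<And>u' w'. u' \<notin> supp f \<Longrightarrow> w' \<notin> supp f \<Longrightarrow> u' \<noteq> w' \<Longrightarrow> \<not> mul_sep u u' w w' f"
proof -
  have "\<exists>u\<in>supp f. \<exists>w\<in>supp f. (u \<in> U) \<noteq> (w \<in> U) \<and>
       (\<forall>u' w'. u' \<notin> supp f \<longrightarrow> w' \<notin> supp f \<longrightarrow> u' \<noteq> w' \<longrightarrow> \<not> mul_sep u u' w w' f)"
    using assms unfolding connected_def by simp
  then show ?thesis using that by (elim bexE conjE) simp
qed

text \<open>A single variable admits no proper cut. Otherwise \<open>common_separation\<close>,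
  applied to the blocks and the cut, yields a pair across the cut that is additively, hence not
  multiplicatively, separated.\<close>

lemma sum_like_connected:
  assumes "sum_like f"
  shows "connected f"
  unfolding connected_def
proof (intro conjI allI impI)
  fix U assume U: "supp f \<inter> U \<noteq> {}" "\<not> supp f \<subseteq> U"
  then obtain x y where xy: "x \<in> supp f" "y \<in> supp f" "(x \<in> U) \<noteq> (y \<in> U)" by blast
  then have "\<not> (\<exists>i. f = zvar i \<or> f = - zvar i)" by auto
  then obtain b where b: "sum_blocks b f" using assms by (auto simp: sum_like_def)
  then obtain x' y' where "x' \<in> supp f" "y' \<in> supp f" "b x' \<noteq> b y'"
    unfolding sum_blocks_def by blast
  then obtain u w where uw: "u \<in> supp f" "w \<in> supp f" "b u \<noteq> b w" "(u \<in> U) \<noteq> (w \<in> U)"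
    using common_separation[of x' "supp f" y' b x y "\<lambda>u. u \<in> U"] xy by blast
  then have "\<not> mul_sep u u' w w' f" if "u' \<notin> supp f" "w' \<notin> supp f" "u' \<noteq> w'" for u' w'
    using b that by (intro not_add_sep_and_mul_sep) (auto simp: sum_blocks_def)
  then show "\<exists>u\<in>supp f. \<exists>w\<in>supp f. (u \<in> U) \<noteq> (w \<in> U) \<and>
       (\<forall>u' w'. u' \<notin> supp f \<longrightarrow> w' \<notin> supp f \<longrightarrow> u' \<noteq> w' \<longrightarrow> \<not> mul_sep u u' w w' f)"
    using uw by blast
qed (use assms sum_like_nonzero sum_like_supp_nonempty in auto)

lemma connected_inverse: "connected f \<Longrightarrow> connected (inverse f)"
  by (simp add: connected_def mul_sep_inverse_iff)

lemma supp_const_mult: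
  assumes "supp e = {}" "e \<noteq> 0"
  shows "supp (e * f) = supp f"
proof
  have "f = inverse e * (e * f)" using assms(2) by (simp flip: mult.assoc)
  then show "supp f \<subseteq> supp (e * f)"
    using supp_mult[of "inverse e" "e * f"] assms(1) by (metis sup_bot_left supp_inverse)
qed (use supp_mult[of e f] assms(1) in simp)

text \<open>If \<open>supp (k y)\<close> cuts \<open>supp (h x)\<close>, take an edge
  \<open>u, w\<close> across the cut. No factor \<open>k z\<close> contains both ends, so the whole
  product is multiplicatively separated; dividing by the other \<open>h z\<close>, which contain
  neither end, separates \<open>h x\<close> itself, a contradiction.\<close>

lemma connected_factor_supp:
  assumes "finite I" "disjoint_family_on (\<lambda>x. supp (h x)) I" "\<And>x. x \<in> I \<Longrightarrow> connected (h x)"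
    and "finite J" "disjoint_family_on (\<lambda>y. supp (k y)) J" "\<And>y. y \<in> J \<Longrightarrow> k y \<noteq> 0"
    and "(\<Prod>x\<in>I. h x) = e * (\<Prod>y\<in>J. k y)" "supp e = {}" "e \<noteq> 0"
    and "x \<in> I"
  shows "\<exists>y\<in>J. supp (h x) \<subseteq> supp (k y)"
proof -
  let ?F = "\<Prod>x\<in>I. h x"
  have hnz: "h x \<noteq> 0" if "x \<in> I" for x using assms(3)[OF that] by (simp add: connected_def)
  have suppI: "supp ?F = (\<Union>x\<in>I. supp (h x))"
    using assms hnz by (intro supp_prod_disjoint) auto
  have suppJ: "supp ?F = (\<Union>y\<in>J. supp (k y))"
    using assms supp_prod_disjoint[of J k] by (simp add: supp_const_mult)
  obtain u0 where "u0 \<in> supp (h x)" using assms(3)[OF assms(10)] unfolding connected_def by blast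
  then obtain y where y: "y \<in> J" "u0 \<in> supp (k y)" using suppI suppJ assms(10) by blast
  have "supp (h x) \<subseteq> supp (k y)"
  proof (rule ccontr)
    assume nsub: "\<not> supp (h x) \<subseteq> supp (k y)"
    have "supp (h x) \<inter> supp (k y) \<noteq> {}" using \<open>u0 \<in> supp (h x)\<close> y by blast
    from connectedE[OF assms(3)[OF assms(10)] this nsub] obtain u w where uw: "u \<in> supp (h x)" "w \<in> supp (h x)"
        "(u \<in> supp (k y)) \<noteq> (w \<in> supp (k y))"
      and nsep: "\<And>u' w'. u' \<notin> supp (h x) \<Longrightarrow> w' \<notin> supp (h x) \<Longrightarrow> u' \<noteq> w' \<Longrightarrow> \<not> mul_sep u u' w w' (h x)"
      by metis
    obtain u' where u': "u' \<notin> supp ?F"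
      using ex_new_if_finite[OF infinite_UNIV_nat, of "supp ?F"] by auto
    obtain w' where w': "w' \<notin> insert u' (supp ?F)"
      using ex_new_if_finite[OF infinite_UNIV_nat, of "insert u' (supp ?F)"] by auto
    have uwF: "u \<in> supp ?F" "w \<in> supp ?F" using uw suppI assms(10) by auto
    have dist: "{u, u'} \<inter> {w, w'} = {}" using uw uwF u' w' by auto
    have "mul_sep u u' w w' (k z)" if z: "z \<in> J" for z
    proof (rule mul_sep_fresh[OF dist])
      have "u \<notin> supp (k z) \<or> w \<notin> supp (k z)"
      proof (cases "z = y")
        case False
        then have "supp (k z) \<inter> supp (k y) = {}"
          using assms(5) z y by (auto simp: disjoint_family_on_def)
        then show ?thesis using uw(3) by blast
      qed (use uw in blast)
      moreover have "u' \<notin> supp (k z)" "w' \<notin> supp (k z)" using z u' w' suppJ by auto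
      ultimately show "{u, u'} \<inter> supp (k z) = {} \<or> {w, w'} \<inter> supp (k z) = {}" by auto
    qed
    then have "mul_sep u u' w w' (\<Prod>y\<in>J. k y)" by (rule mul_sep_prod)
    moreover have "mul_sep u u' w w' e" using assms(8) by (intro mul_sep_fresh[OF dist]) auto
    ultimately have "mul_sep u u' w w' ?F" unfolding assms(7) by (intro mul_sep_mult)
    moreover have "mul_sep u u' w w' (\<Prod>z\<in>I - {x}. h z)"
    proof (intro mul_sep_prod mul_sep_fresh[OF dist])
      fix z assume z: "z \<in> I - {x}"
      then have "supp (h z) \<inter> supp (h x) = {}"
        using assms(2,10) by (auto simp: disjoint_family_on_def)
      then show "{u, u'} \<inter> supp (h z) = {} \<or> {w, w'} \<inter> supp (h z) = {}"
        using z uw u' suppI by auto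
    qed
    moreover have "h x = ?F * inverse (\<Prod>z\<in>I - {x}. h z)"
      using assms(1) hnz by (simp add: prod.remove[OF assms(1,10)] mult.assoc)
    ultimately have "mul_sep u u' w w' (h x)"
      by (simp add: mul_sep_mult mul_sep_inverse_iff)
    then show False using nsep[of u' w'] u' w' suppI assms(10) by auto
  qed
  then show ?thesis using y by blast
qed

text \<open>Inclusions in both directions,
  \<open>supp (h x) \<subseteq> supp (k y) \<subseteq> supp (h x')\<close>, force
  \<open>x = x'\<close> by disjointness, so the supports on the two sides are the same sets.\<close>

lemma connected_factors_match:
  assumes "finite I" "disjoint_family_on (\<lambda>x. supp (h x)) I" "\<And>x. x \<in> I \<Longrightarrow> connected (h x)"
    and "finite J" "disjoint_family_on (\<lambda>y. supp (k y)) J" "\<And>y. y \<in> J \<Longrightarrow> connected (k y)"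
    and "(\<Prod>x\<in>I. h x) = e * (\<Prod>y\<in>J. k y)" "supp e = {}" "e \<noteq> 0"
  shows "\<exists>\<phi>. bij_betw \<phi> I J \<and> (\<forall>x\<in>I. supp (h x / k (\<phi> x)) = {})"
proof -
  have ne: "supp (h x) \<noteq> {}" if "x \<in> I" for x using assms(3) that by (auto simp: connected_def)
  have ne': "supp (k y) \<noteq> {}" if "y \<in> J" for y using assms(6) that by (auto simp: connected_def)
  have knz: "k y \<noteq> 0" if "y \<in> J" for y using assms(6) that by (auto simp: connected_def)
  have hnz: "h x \<noteq> 0" if "x \<in> I" for x using assms(3) that by (auto simp: connected_def)
  have eq': "(\<Prod>y\<in>J. k y) = inverse e * (\<Prod>x\<in>I. h x)"
    using assms(7,9) by (simp flip: mult.assoc)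
  have to: "\<exists>y\<in>J. supp (h x) \<subseteq> supp (k y)" if "x \<in> I" for x
    using connected_factor_supp[OF assms(1-3,4,5) knz assms(7-9) that] by blast
  have fro: "\<exists>x\<in>I. supp (k y) \<subseteq> supp (h x)" if "y \<in> J" for y
    using connected_factor_supp[OF assms(4-6,1,2) hnz eq' _ _ that] assms(8,9) by simp
  have inj: "x = x'" if "x \<in> I" "x' \<in> I" "supp (h x) \<inter> supp (h x') \<noteq> {}" for x x'
    using that assms(2) unfolding disjoint_family_on_def by blast
  have inj': "y = y'" if "y \<in> J" "y' \<in> J" "supp (k y) \<inter> supp (k y') \<noteq> {}" for y y'
    using that assms(5) unfolding disjoint_family_on_def by blast
  have "\<exists>y\<in>J. supp (h x) = supp (k y)" if x: "x \<in> I" for x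
  proof -
    obtain y where y: "y \<in> J" "supp (h x) \<subseteq> supp (k y)" using to x by blast
    obtain x' where x': "x' \<in> I" "supp (k y) \<subseteq> supp (h x')" using fro y by blast
    have "x = x'" using inj[OF x x'(1)] ne[OF x] y x' by blast
    then show ?thesis using y x' by blast
  qed
  then obtain \<phi> where \<phi>: "\<And>x. x \<in> I \<Longrightarrow> \<phi> x \<in> J \<and> supp (h x) = supp (k (\<phi> x))" by metis
  have "bij_betw \<phi> I J"
  proof (rule bij_betwI')
    fix x x' assume "x \<in> I" "x' \<in> I"
    then show "(\<phi> x = \<phi> x') = (x = x')" using inj[of x x'] \<phi>[of x] \<phi>[of x'] ne[of x] by (metis Int_absorb)
  next
    fix y assume y: "y \<in> J"
    then obtain x where x: "x \<in> I" "supp (k y) \<subseteq> supp (h x)" using fro by blast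
    have "y = \<phi> x" using inj'[of y "\<phi> x"] y x \<phi>[OF x(1)] ne'[OF y] by blast
    then show "\<exists>x\<in>I. y = \<phi> x" using x by blast
  qed (use \<phi> in blast)
  \<comment> \<open>The quotient has variables in \<open>supp (h x)\<close> only, yet it equals a
    constant times a quotient of the remaining factors, which avoid that set.\<close>
  moreover have "supp (h x / k (\<phi> x)) = {}" if x: "x \<in> I" for x
  proof -
    let ?H = "\<Prod>z\<in>I - {x}. h z" and ?K = "\<Prod>z\<in>J - {\<phi> x}. k z"
    have y: "\<phi> x \<in> J" "supp (k (\<phi> x)) = supp (h x)" using \<phi>[OF x] by auto
    have nzs: "?H \<noteq> 0" "?K \<noteq> 0" "k (\<phi> x) \<noteq> 0" using hnz knz y assms(1,4) by auto
    have "h x * ?H = e * (k (\<phi> x) * ?K)"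
      using assms(7) by (simp add: prod.remove[OF assms(1) x] prod.remove[OF assms(4) y(1)])
    then have "h x / k (\<phi> x) = e * (?K * inverse ?H)"
      using nzs by (simp add: field_simps)
    then have "supp (h x / k (\<phi> x)) \<subseteq> supp ?K \<union> supp ?H"
      using supp_mult[of ?K "inverse ?H"] assms(8,9) by (simp add: supp_const_mult)
    moreover have "supp ?H \<inter> supp (h x) = {}"
      using supp_prod[of h "I - {x}"] inj[OF x] by blast
    moreover have "supp ?K \<inter> supp (h x) = {}"
      using supp_prod[of k "J - {\<phi> x}"] inj'[OF y(1)] y(2) by blast
    moreover have "supp (h x / k (\<phi> x)) \<subseteq> supp (h x)"
      using supp_mult[of "h x" "inverse (k (\<phi> x))"] y(2) by (simp add: divide_inverse)
    ultimately show ?thesis by blast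
  qed
  ultimately show ?thesis by blast
qed

text \<open>This forbids matching a numerator factor with a denominator factor. A constant product
  would give both the same support. If both have blocks, a pair separated by both labellings
  contradicts \<open>not_add_sep_and_add_sep_quotient\<close>; otherwise both are the same variable
  up to sign, whose square is not constant.\<close>

lemma sum_like_mult_not_const:
  assumes "sum_like f" "sum_like g"
  shows "supp (f * g) \<noteq> {}"
proof
  assume c: "supp (f * g) = {}"
  have nz: "f \<noteq> 0" "g \<noteq> 0" using assms sum_like_nonzero by auto
  have "g = f * g * inverse f" using nz by simp
  then have "supp g = supp f"
    using supp_const_mult[OF c, of "inverse f"] nz by (metis mult_eq_0_iff supp_inverse)
  show False
  proof (cases "(\<exists>b. sum_blocks b f) \<and> (\<exists>b. sum_blocks b g)")
    case True
    then obtain b b' where b: "sum_blocks b f" "sum_blocks b' g" by blast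
    obtain x y where xy: "x \<in> supp f" "y \<in> supp f" "b x \<noteq> b y" using b(1) by (auto simp: sum_blocks_def)
    obtain x' y' where xy': "x' \<in> supp f" "y' \<in> supp f" "b' x' \<noteq> b' y'"
      using b(2) \<open>supp g = supp f\<close> by (auto simp: sum_blocks_def)
    obtain u w where uw: "u \<in> supp f" "w \<in> supp f" "b u \<noteq> b w" "b' u \<noteq> b' w"
      using common_separation[OF xy xy'] by blast
    obtain u' where u': "u' \<notin> supp f"
      using ex_new_if_finite[OF infinite_UNIV_nat, of "supp f"] by auto
    obtain w' where w': "w' \<notin> insert u' (supp f)"
      using ex_new_if_finite[OF infinite_UNIV_nat, of "insert u' (supp f)"] by auto
    have "add_sep u u' w w' f" "add_sep u u' w w' g"
      using b uw u' w' \<open>supp g = supp f\<close> unfolding sum_blocks_def by auto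
    then show False
      using not_add_sep_and_add_sep_quotient[OF uw(1,2) u', of w' "g" "f * g"] uw w' c nz by auto
  next
    case False
    have two: "\<exists>u\<in>supp f. \<exists>w\<in>supp f. u \<noteq> w" if "sum_blocks b h" "supp h = supp f" for b h
      using that unfolding sum_blocks_def by metis
    have one: "\<not> (\<exists>u\<in>supp f. \<exists>w\<in>supp f. u \<noteq> w)" if "supp f = {i}" for i using that by auto
    have "(\<exists>i. f = zvar i \<or> f = - zvar i) \<or> (\<exists>i. g = zvar i \<or> g = - zvar i)"
      using assms False by (auto simp: sum_like_def)
    then have "\<exists>i. supp f = {i}" using \<open>supp g = supp f\<close> by (metis supp_uminus supp_zvar)
    then obtain i where i: "supp f = {i}" ..
    let ?X = "Poly_Mapping.single (Poly_Mapping.single i 1) 1 :: zpoly"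
    from i have "(\<exists>i. f = zvar i \<or> f = - zvar i) \<and> (\<exists>i. g = zvar i \<or> g = - zvar i)"
      using assms two one \<open>supp g = supp f\<close> unfolding sum_like_def by metis
    then have "f = zvar i \<or> f = - zvar i" "g = zvar i \<or> g = - zvar i"
      using i \<open>supp g = supp f\<close> by auto
    then have "supp (zvar i * zvar i) = {}"
      using c by (metis minus_mult_left minus_mult_right supp_uminus)
    moreover have "zvar i * zvar i = Fract (?X * ?X) 1"
      by (simp add: zvar_def)
    ultimately have "lead_monom (?X * ?X) = lead_monom 1"
      by (intro lead_monom_eq_of_supp_empty) auto
    then have "Poly_Mapping.single i 1 + Poly_Mapping.single i (1::nat) = 0"
      by (subst (asm) lead_monom_mult) auto
    then have "Poly_Mapping.lookup (Poly_Mapping.single i 1 + Poly_Mapping.single i (1::nat)) i = 0"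
      by simp
    then show False by (simp add: lookup_add)
  qed
qed

subsection \<open>Constants are signs\<close>

lemma monom_add_disjoint_cancel:
  assumes "m1 + n1 = m2 + (n2 :: nat \<Rightarrow>\<^sub>0 nat)"
    and "Poly_Mapping.keys m1 \<subseteq> A" "Poly_Mapping.keys m2 \<subseteq> A"
    and "Poly_Mapping.keys n1 \<subseteq> B" "Poly_Mapping.keys n2 \<subseteq> B" "A \<inter> B = {}"
  shows "m1 = m2"
proof (rule poly_mapping_eqI)
  fix i
  have eq: "Poly_Mapping.lookup m1 i + Poly_Mapping.lookup n1 i = Poly_Mapping.lookup m2 i + Poly_Mapping.lookup n2 i"
    using assms(1) by (metis lookup_add)
  show "Poly_Mapping.lookup m1 i = Poly_Mapping.lookup m2 i"
  proof (cases "i \<in> A")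
    case True
    then have "i \<notin> Poly_Mapping.keys n1" "i \<notin> Poly_Mapping.keys n2" using assms by auto
    then show ?thesis using eq by (simp add: in_keys_iff)
  next
    case False
    then have "i \<notin> Poly_Mapping.keys m1" "i \<notin> Poly_Mapping.keys m2" using assms by auto
    then show ?thesis by (simp add: in_keys_iff)
  qed
qed

lemma keys_lead_monom: "P \<noteq> 0 \<Longrightarrow> Poly_Mapping.keys (lead_monom P) \<subseteq> poly_vars P"
  using lead_monom_in_keys[of P] by (auto simp: poly_vars_def)

text \<open>The invariant that excludes constants other than \<open>1\<close> and \<open>-1\<close>.
  The set \<open>A\<close> is an upper bound, so the representation may contain common factors;
  distinct leading monomials keep the invariant stable under sums.\<close>

definition tame_rep :: "nat set \<Rightarrow> zfrac \<Rightarrow> zpoly \<Rightarrow> zpoly \<Rightarrow> bool" where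
  "tame_rep A f P Q \<longleftrightarrow> P \<noteq> 0 \<and> Q \<noteq> 0 \<and> f = Fract P Q \<and> poly_vars P \<subseteq> A \<and> poly_vars Q \<subseteq> A \<and>
     \<bar>lead_coef P\<bar> = \<bar>lead_coef Q\<bar> \<and> lead_monom P \<noteq> lead_monom Q"

definition tame :: "nat set \<Rightarrow> zfrac \<Rightarrow> bool" where
  "tame A f \<longleftrightarrow> (\<exists>P Q. tame_rep A f P Q)"

lemma tame_nonzero: "tame A f \<Longrightarrow> f \<noteq> 0"
  by (auto simp: tame_def tame_rep_def Zero_fract_def eq_fract)

text \<open>Both conditions on leading terms survive cross multiplication, so they pass to a
  canonical representation, whose variables lie in \<open>Var f\<close>.\<close>

lemma tame_Var:
  assumes "tame A f"
  shows "tame (Var f) f"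
proof -
  obtain P Q where PQ: "tame_rep A f P Q" using assms by (auto simp: tame_def)
  obtain R S where RS: "S \<noteq> 0" "zpoly_coprime R S" "f = Fract R S"
    using canonical_rep_exists by blast
  have eq: "P * S = R * Q" using PQ RS by (auto simp: tame_rep_def eq_fract)
  then have "R \<noteq> 0" using PQ RS by (auto simp: tame_rep_def)
  have "lead_coef P * lead_coef S = lead_coef R * lead_coef Q"
    using arg_cong[OF eq, of lead_coef] by (simp add: lead_coef_mult)
  then have "\<bar>lead_coef Q\<bar> * \<bar>lead_coef S\<bar> = \<bar>lead_coef Q\<bar> * \<bar>lead_coef R\<bar>"
    using PQ unfolding tame_rep_def by (metis abs_mult mult.commute)
  then have lc: "\<bar>lead_coef R\<bar> = \<bar>lead_coef S\<bar>"
    using PQ lead_coef_nonzero[of Q] by (simp add: tame_rep_def)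
  have "lead_monom P + lead_monom S = lead_monom R + lead_monom Q"
    using arg_cong[OF eq, of lead_monom] PQ RS \<open>R \<noteq> 0\<close> by (simp add: lead_monom_mult tame_rep_def)
  then have "lead_monom R \<noteq> lead_monom S"
    using PQ by (auto simp: tame_rep_def add.commute)
  then have "tame_rep (Var f) f R S"
    using RS \<open>R \<noteq> 0\<close> lc by (auto simp: tame_rep_def Var_def)
  then show ?thesis by (auto simp: tame_def)
qed

lemma tame_uminus: "tame A f \<Longrightarrow> tame A (- f)"
  unfolding tame_def tame_rep_def
  by (metis minus_fract lead_coef_uminus lead_monom_uminus abs_minus_cancel neg_equal_0_iff_equal poly_vars_uminus)

lemma tame_inverse: "tame A f \<Longrightarrow> tame A (inverse f)"
  unfolding tame_def tame_rep_def by (metis inverse_fract)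

lemma tame_zvar: "tame {i} (zvar i)"
proof -
  have "Poly_Mapping.single i (1::nat) \<noteq> 0"
    by (metis lookup_single_eq lookup_zero one_neq_zero)
  then have "tame_rep {i} (zvar i) (Poly_Mapping.single (Poly_Mapping.single i 1) 1) 1"
    by (simp add: tame_rep_def zvar_def poly_vars_def)
  then show ?thesis by (auto simp: tame_def)
qed

text \<open>Equal leading monomials of the products would, restricted to \<open>A\<close>, give
  equal leading monomials in the representation of \<open>f\<close>.\<close>

lemma tame_mult:
  assumes "tame A f" "tame B g" "A \<inter> B = {}"
  shows "tame (A \<union> B) (f * g)"
proof -
  obtain P Q R S where PQ: "tame_rep A f P Q" and RS: "tame_rep B g R S"
    using assms by (auto simp: tame_def)
  note d = PQ[unfolded tame_rep_def] RS[unfolded tame_rep_def]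
  have "lead_monom P + lead_monom R \<noteq> lead_monom Q + lead_monom S"
    using monom_add_disjoint_cancel[of "lead_monom P" "lead_monom R" "lead_monom Q" "lead_monom S" A B]
      keys_lead_monom[of P] keys_lead_monom[of Q] keys_lead_monom[of R] keys_lead_monom[of S] d assms(3)
    by blast
  then have "tame_rep (A \<union> B) (f * g) (P * R) (Q * S)"
    using d poly_vars_mult[of P R] poly_vars_mult[of Q S]
    by (auto simp: tame_rep_def lead_monom_mult lead_coef_mult abs_mult)
  then show ?thesis by (auto simp: tame_def)
qed

text \<open>The leading monomials of \<open>P * S\<close> and \<open>R * Q\<close> differ, so leading terms cannot cancel in the
  numerator of \<open>P / Q + R / S\<close>.\<close>

lemma tame_add:
  assumes "tame A f" "tame B g" "A \<inter> B = {}"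
  shows "tame (A \<union> B) (f + g)"
proof -
  obtain P Q R S where PQ: "tame_rep A f P Q" and RS: "tame_rep B g R S"
    using assms by (auto simp: tame_def)
  note d = PQ[unfolded tame_rep_def] RS[unfolded tame_rep_def]
  have nz: "P \<noteq> 0" "Q \<noteq> 0" "R \<noteq> 0" "S \<noteq> 0" using d by auto
  have ne: "lead_monom (P * S) \<noteq> lead_monom (R * Q)"
    using monom_add_disjoint_cancel[of "lead_monom P" "lead_monom S" "lead_monom Q" "lead_monom R" A B]
      keys_lead_monom[of P] keys_lead_monom[of Q] keys_lead_monom[of R] keys_lead_monom[of S] d assms(3)
    unfolding lead_monom_mult[OF nz(1,4)] lead_monom_mult[OF nz(3,2)] add.commute[of "lead_monom R"]
    by blast
  have "P * S + R * Q \<noteq> 0 \<and> \<bar>lead_coef (P * S + R * Q)\<bar> = \<bar>lead_coef (Q * S)\<bar> \<and>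
      lead_monom (P * S + R * Q) \<noteq> lead_monom (Q * S)"
  proof (cases "lead_monom (R * Q) < lead_monom (P * S)")
    case True
    then show ?thesis
      using lead_add_less[of "P * S" "R * Q"] nz d
      by (simp add: lead_coef_mult lead_monom_mult abs_mult)
  next
    case False
    then have "lead_monom (P * S) < lead_monom (R * Q)" using ne by simp
    then show ?thesis
      using lead_add_less[of "R * Q" "P * S"] nz d
      by (simp add: lead_coef_mult lead_monom_mult abs_mult add.commute)
  qed
  moreover have "poly_vars (P * S + R * Q) \<subseteq> A \<union> B" "poly_vars (Q * S) \<subseteq> A \<union> B"
    using poly_vars_add[of "P * S" "R * Q"] poly_vars_mult[of P S] poly_vars_mult[of R Q]
      poly_vars_mult[of Q S] d by blast+
  ultimately have "tame_rep (A \<union> B) (f + g) (P * S + R * Q) (Q * S)"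
    using d by (simp add: tame_rep_def)
  then show ?thesis by (auto simp: tame_def)
qed

lemma tame_sum:
  assumes "finite I" "I \<noteq> {}" "disjoint_family_on A I" "\<And>i. i \<in> I \<Longrightarrow> tame (A i) (f i)"
  shows "tame (\<Union>i\<in>I. A i) (\<Sum>i\<in>I. f i)"
  using assms
proof (induction I rule: finite_ne_induct)
  case (insert x F)
  have "A x \<inter> (\<Union>i\<in>F. A i) = {}"
    using insert.prems(1) insert.hyps by (auto simp: disjoint_family_on_def)
  moreover have "disjoint_family_on A F"
    using insert.prems(1) by (auto simp: disjoint_family_on_def)
  ultimately show ?case
    using insert tame_add[of "A x" "f x" "\<Union>i\<in>F. A i" "\<Sum>i\<in>F. f i"] by simp
qed auto

text \<open>The index set is nonempty because the empty product \<open>1\<close> is not tame: its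
  numerator and denominator coincide.\<close>

lemma tame_prod:
  assumes "finite I" "I \<noteq> {}" "disjoint_family_on A I" "\<And>i. i \<in> I \<Longrightarrow> tame (A i) (f i)"
  shows "tame (\<Union>i\<in>I. A i) (\<Prod>i\<in>I. f i)"
  using assms
proof (induction I rule: finite_ne_induct)
  case (insert x F)
  have "A x \<inter> (\<Union>i\<in>F. A i) = {}"
    using insert.prems(1) insert.hyps by (auto simp: disjoint_family_on_def)
  moreover have "disjoint_family_on A F"
    using insert.prems(1) by (auto simp: disjoint_family_on_def)
  ultimately show ?case
    using insert tame_mult[of "A x" "f x" "\<Union>i\<in>F. A i" "\<Prod>i\<in>F. f i"] by simp
qed auto

text \<open>The operands are tame over their own \<open>Var\<close> sets, which are disjoint;
  \<open>tame_Var\<close> then replaces the union of these sets by \<open>Var\<close> of the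
  result.\<close>

lemma expr_tame:
  "sum_type k f \<Longrightarrow> tame (Var f) f"
  "prod_type k f \<Longrightarrow> tame (Var f) f"
proof (induction rule: sum_type_prod_type.inducts)
  case (sum s f k)
  have "tame (\<Union>i\<in>{1..s}. Var (f i)) (\<Sum>i=1..s. f i)"
    using sum by (intro tame_sum) auto
  then show ?case by (rule tame_Var)
next
  case (prod s t f k g)
  have vd: "disjoint_family_on (\<lambda>i. Var (f i)) {1..s}" "disjoint_family_on (\<lambda>j. Var (g j)) {1..t}"
      "(\<Union>i\<in>{1..s}. Var (f i)) \<inter> (\<Union>j\<in>{1..t}. Var (g j)) = {}"
    using \<open>vars_disjoint s f t g\<close> by (auto simp: vars_disjoint_def)
  have F: "tame (\<Union>i\<in>{1..s}. Var (f i)) (\<Prod>i=1..s. f i)"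
    using prod vd by (intro tame_prod) auto
  show ?case
  proof (cases "t = 0")
    \<comment> \<open>The denominator is the empty product, to which \<open>tame_prod\<close> does
      not apply.\<close>
    case True
    then show ?thesis using tame_Var[OF F] by simp
  next
    case False
    have G: "tame (\<Union>j\<in>{1..t}. Var (g j)) (\<Prod>j=1..t. g j)"
      using prod vd False by (intro tame_prod) auto
    show ?thesis
      unfolding divide_inverse by (rule tame_Var[OF tame_mult[OF F tame_inverse[OF G] vd(3)]])
  qed
qed (auto intro: tame_Var tame_zvar tame_uminus)

text \<open>The quotient is \<open>(P * S) / (Q * R)\<close>, whose leading coefficients again agree
  in absolute value, so \<open>supp_empty_unit\<close> applies.\<close>

lemma tame_quotient_const:
  assumes "tame A f" "tame B g" "supp (f / g) = {}"
  shows "eq_up_to_sign f g"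
proof -
  obtain P Q R S where PQ: "tame_rep A f P Q" and RS: "tame_rep B g R S"
    using assms by (auto simp: tame_def)
  note d = PQ[unfolded tame_rep_def] RS[unfolded tame_rep_def]
  have fg: "f / g = Fract (P * S) (Q * R)" using d by simp
  have "f / g = 1 \<or> f / g = - 1"
    using d assms(3) unfolding fg by (intro supp_empty_unit) (auto simp: lead_coef_mult abs_mult)
  then show ?thesis using tame_nonzero[OF assms(2)] by (auto simp: eq_up_to_sign_def field_simps)
qed

subsection \<open>Uniqueness of the factors\<close>

lemma eq_up_to_sign_prod:
  assumes "finite I" "\<And>i. i \<in> I \<Longrightarrow> eq_up_to_sign (f i) (g i)"
  shows "eq_up_to_sign (\<Prod>i\<in>I. f i) (\<Prod>i\<in>I. g i)"
  using assms
proof (induction I rule: finite_induct)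
  case (insert x F)
  then have "eq_up_to_sign (f x) (g x)" "eq_up_to_sign (\<Prod>i\<in>F. f i) (\<Prod>i\<in>F. g i)" by auto
  then show ?case using insert.hyps by (auto simp: eq_up_to_sign_def)
qed (simp add: eq_up_to_sign_def)

text \<open>\<open>permutes\<close> demands the identity outside \<open>A\<close>, hence the
  extension of \<open>\<pi>\<close>.\<close>

lemma bij_betw_permutes:
  assumes "bij_betw \<pi> A A"
  shows "(\<lambda>x. if x \<in> A then \<pi> x else x) permutes A"
proof (rule bij_imp_permutes)
  show "bij_betw (\<lambda>x. if x \<in> A then \<pi> x else x) A A"
    using assms by (subst bij_betw_cong[of A _ \<pi>]) auto
qed simp

theorem theorem3p3:
  fixes s1 t1 s2 t2 :: nat
    and f1 g1 f2 g2 :: "nat \<Rightarrow> zfrac"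
  assumes "s1 \<ge> 1" and "s1 + t1 \<ge> 2"
    and "s2 \<ge> 1" and "s2 + t2 \<ge> 2"
    and "\<And>i. i \<in> {1..s1} \<Longrightarrow> is_sum_type (f1 i)"
    and "\<And>j. j \<in> {1..t1} \<Longrightarrow> is_sum_type (g1 j)"
    and "\<And>i. i \<in> {1..s2} \<Longrightarrow> is_sum_type (f2 i)"
    and "\<And>j. j \<in> {1..t2} \<Longrightarrow> is_sum_type (g2 j)"
    and "vars_disjoint s1 f1 t1 g1"
    and "vars_disjoint s2 f2 t2 g2"
    and "\<exists>k>0. prod_type k ((\<Prod>i=1..s1. f1 i) / (\<Prod>j=1..t1. g1 j))"
    and "\<exists>k>0. prod_type k ((\<Prod>i=1..s2. f2 i) / (\<Prod>j=1..t2. g2 j))"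
  shows "eq_up_to_sign ((\<Prod>i=1..s1. f1 i) / (\<Prod>j=1..t1. g1 j))
                       ((\<Prod>i=1..s2. f2 i) / (\<Prod>j=1..t2. g2 j))
    \<longleftrightarrow> s2 = s1 \<and> t2 = t1 \<and>
      (\<exists>\<pi> \<sigma>. \<pi> permutes {1..s1} \<and> \<sigma> permutes {1..t1} \<and>
        (\<forall>i\<in>{1..s1}. eq_up_to_sign (f2 (\<pi> i)) (f1 i)) \<and>
        (\<forall>j\<in>{1..t1}. eq_up_to_sign (g2 (\<sigma> j)) (g1 j)))"
    (is "eq_up_to_sign ?F1 ?F2 \<longleftrightarrow> ?R")
proof
  assume ?R
  then obtain \<pi> \<sigma> where s: "s2 = s1" "t2 = t1" and perm: "\<pi> permutes {1..s1}" "\<sigma> permutes {1..t1}"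
    and f: "\<And>i. i \<in> {1..s1} \<Longrightarrow> eq_up_to_sign (f2 (\<pi> i)) (f1 i)"
    and g: "\<And>j. j \<in> {1..t1} \<Longrightarrow> eq_up_to_sign (g2 (\<sigma> j)) (g1 j)"
    by blast
  have "eq_up_to_sign (\<Prod>i=1..s1. f2 (\<pi> i)) (\<Prod>i=1..s1. f1 i)"
    "eq_up_to_sign (\<Prod>j=1..t1. g2 (\<sigma> j)) (\<Prod>j=1..t1. g1 j)"
    using f g by (auto intro: eq_up_to_sign_prod)
  moreover have "(\<Prod>i=1..s1. f2 (\<pi> i)) = (\<Prod>i=1..s1. f2 i)"
    "(\<Prod>j=1..t1. g2 (\<sigma> j)) = (\<Prod>j=1..t1. g2 j)"
    using prod.permute[OF perm(1), of f2] prod.permute[OF perm(2), of g2] by (simp_all add: comp_def)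
  ultimately show "eq_up_to_sign ?F1 ?F2"
    unfolding s by (auto simp: eq_up_to_sign_def)
next
  assume "eq_up_to_sign ?F1 ?F2"
  then obtain e :: zfrac where e: "e = 1 \<or> e = - 1" "?F1 = e * ?F2"
    unfolding eq_up_to_sign_def by (metis mult_1 mult_minus1)
  \<comment> \<open>Numerator factors and inverted denominator factors form one family over a
    disjoint union of index sets, so that each fraction is a single product.\<close>
  define h where "h f g = case_sum f (\<lambda>j. inverse (g j))" for f g :: "nat \<Rightarrow> zfrac"
  define I :: "nat \<Rightarrow> nat \<Rightarrow> (nat + nat) set" where "I s t = {1..s} <+> {1..t}" for s t
  have I_iff: "Inl i \<in> I s t \<longleftrightarrow> i \<in> {1..s}" "Inr j \<in> I s t \<longleftrightarrow> j \<in> {1..t}" for i j s t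
    by (auto simp: I_def)
  have prod_h: "(\<Prod>x\<in>I s t. h f g x) = (\<Prod>i=1..s. f i) / (\<Prod>j=1..t. g j)" for s t f g
    using prod_inversef[of g "{1..t}"] by (simp add: I_def h_def prod.Plus divide_inverse comp_def)
  have disj: "disjoint_family_on (\<lambda>x. supp (h f g x)) (I s t)" if "vars_disjoint s f t g" for s t f g
  proof -
    have dj: "disjoint_family_on (\<lambda>i. supp (f i)) {1..s}" "disjoint_family_on (\<lambda>j. supp (g j)) {1..t}"
      using that by (auto simp: vars_disjoint_def intro: disjoint_supp)
    have ff: "supp (f i) \<inter> supp (f i') = {}" if "i \<in> {1..s}" "i' \<in> {1..s}" "i \<noteq> i'" for i i'
      using dj that unfolding disjoint_family_on_def by blast
    have gg: "supp (g j) \<inter> supp (g j') = {}" if "j \<in> {1..t}" "j' \<in> {1..t}" "j \<noteq> j'" for j j'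
      using dj that unfolding disjoint_family_on_def by blast
    have fg: "supp (f i) \<inter> supp (g j) = {}" if "i \<in> {1..s}" "j \<in> {1..t}" for i j
    proof -
      have "Var (f i) \<inter> Var (g j) = {}"
        using \<open>vars_disjoint s f t g\<close> that unfolding vars_disjoint_def by blast
      then show ?thesis using supp_subset_Var by blast
    qed
    have gf: "supp (g j) \<inter> supp (f i) = {}" if "i \<in> {1..s}" "j \<in> {1..t}" for i j
      using fg[OF that] by blast
    show ?thesis
      unfolding disjoint_family_on_def
    proof (intro ballI impI)
      fix x y assume "x \<in> I s t" "y \<in> I s t" "x \<noteq> y"
      then show "supp (h f g x) \<inter> supp (h f g y) = {}"
        using ff gg fg gf unfolding I_def h_def by (elim PlusE) (simp_all del: atLeastAtMost_iff)
    qed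
  qed
  have like: "sum_like f" "tame (Var f) f" if "is_sum_type f" for f
    using that sum_type_sum_like expr_tame(1) by (auto simp: is_sum_type_def)
  have conn: "connected (h f g x)"
    if "x \<in> I s t" "\<And>i. i \<in> {1..s} \<Longrightarrow> is_sum_type (f i)" "\<And>j. j \<in> {1..t} \<Longrightarrow> is_sum_type (g j)" for s t f g x
    using that like(1) unfolding I_def h_def
    by (elim PlusE) (simp_all add: sum_like_connected connected_inverse)
  have "\<exists>\<phi>. bij_betw \<phi> (I s1 t1) (I s2 t2) \<and> (\<forall>x\<in>I s1 t1. supp (h f1 g1 x / h f2 g2 (\<phi> x)) = {})"
  proof (rule connected_factors_match)
    show "(\<Prod>x\<in>I s1 t1. h f1 g1 x) = e * (\<Prod>x\<in>I s2 t2. h f2 g2 x)"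
      unfolding prod_h by (rule e(2))
  qed (use e(1) assms conn disj in \<open>auto simp: I_def\<close>)
  then obtain \<phi> where bij: "bij_betw \<phi> (I s1 t1) (I s2 t2)"
    and \<phi>: "\<And>x. x \<in> I s1 t1 \<Longrightarrow> supp (h f1 g1 x / h f2 g2 (\<phi> x)) = {}" by blast
  have memF: "\<exists>i'\<in>{1..s2}. \<phi> (Inl i) = Inl i' \<and> eq_up_to_sign (f2 i') (f1 i)" if i: "i \<in> {1..s1}" for i
  proof -
    have x: "Inl i \<in> I s1 t1" using i by (auto simp: I_iff)
    then have y: "\<phi> (Inl i) \<in> I s2 t2" using bij by (auto simp: bij_betw_def)
    show ?thesis
    proof (cases "\<phi> (Inl i)")
      case (Inl i')
      then have i': "i' \<in> {1..s2}" using y by (auto simp: I_iff)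
      have "supp (f1 i / f2 i') = {}" using \<phi>[OF x] by (simp add: h_def Inl)
      then have "eq_up_to_sign (f1 i) (f2 i')"
        using tame_quotient_const like assms i i' by blast
      then show ?thesis using i' Inl by (auto simp: eq_up_to_sign_def)
    next
      case (Inr j)
      then have j: "j \<in> {1..t2}" using y by (auto simp: I_iff)
      \<comment> \<open>The quotient of \<open>f1 i\<close> by the inverse of \<open>g2 j\<close> is
        a product of two sum-type expressions, which cannot be constant.\<close>
      have "supp (f1 i * g2 j) = {}" using \<phi>[OF x] by (simp add: h_def Inr divide_inverse)
      then show ?thesis using sum_like_mult_not_const like assms i j by blast
    qed
  qed
  have memG: "\<exists>j'\<in>{1..t2}. \<phi> (Inr j) = Inr j' \<and> eq_up_to_sign (g2 j') (g1 j)" if j: "j \<in> {1..t1}" for j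
  proof -
    have x: "Inr j \<in> I s1 t1" using j by (auto simp: I_iff)
    then have y: "\<phi> (Inr j) \<in> I s2 t2" using bij by (auto simp: bij_betw_def)
    show ?thesis
    proof (cases "\<phi> (Inr j)")
      case (Inr j')
      then have j': "j' \<in> {1..t2}" using y by (auto simp: I_iff)
      have "supp (g2 j' / g1 j) = {}" using \<phi>[OF x] by (simp add: h_def Inr divide_inverse mult.commute)
      then have "eq_up_to_sign (g2 j') (g1 j)"
        using tame_quotient_const like assms j j' by blast
      then show ?thesis using j' Inr by auto
    next
      case (Inl i)
      then have i: "i \<in> {1..s2}" using y by (auto simp: I_iff)
      have "supp (inverse (g1 j * f2 i)) = {}" using \<phi>[OF x] by (simp add: h_def Inl divide_inverse)
      then show ?thesis using sum_like_mult_not_const like assms i j by (metis supp_inverse)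
    qed
  qed
  obtain \<pi> where \<pi>: "\<And>i. i \<in> {1..s1} \<Longrightarrow> \<pi> i \<in> {1..s2} \<and> \<phi> (Inl i) = Inl (\<pi> i) \<and> eq_up_to_sign (f2 (\<pi> i)) (f1 i)"
    using memF by metis
  obtain \<sigma> where \<sigma>: "\<And>j. j \<in> {1..t1} \<Longrightarrow> \<sigma> j \<in> {1..t2} \<and> \<phi> (Inr j) = Inr (\<sigma> j) \<and> eq_up_to_sign (g2 (\<sigma> j)) (g1 j)"
    using memG by metis
  have inj: "x = x'" if "x \<in> I s1 t1" "x' \<in> I s1 t1" "\<phi> x = \<phi> x'" for x x'
    using bij that by (auto simp: bij_betw_def dest: inj_onD)
  have surj: "\<exists>x\<in>I s1 t1. \<phi> x = y" if "y \<in> I s2 t2" for y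
    using that unfolding bij_betw_imp_surj_on[OF bij, symmetric] by blast
  have bij\<pi>: "bij_betw \<pi> {1..s1} {1..s2}"
  proof (rule bij_betwI')
    fix i i' assume "i \<in> {1..s1}" "i' \<in> {1..s1}"
    then show "(\<pi> i = \<pi> i') = (i = i')" using inj[of "Inl i" "Inl i'"] \<pi>[of i] \<pi>[of i'] by (auto simp: I_iff)
  next
    fix i' assume "i' \<in> {1..s2}"
    then obtain x where x: "x \<in> I s1 t1" "\<phi> x = Inl i'" using surj[of "Inl i'"] by (auto simp: I_iff)
    \<comment> \<open>The preimage \<open>x\<close> is a numerator index, since by
      \<open>\<sigma>\<close> denominator indices are sent to denominator indices.\<close>
    then show "\<exists>i\<in>{1..s1}. i' = \<pi> i" using \<pi> \<sigma> by (cases x) (auto simp: I_iff simp del: atLeastAtMost_iff)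
  qed (use \<pi> in blast)
  have bij\<sigma>: "bij_betw \<sigma> {1..t1} {1..t2}"
  proof (rule bij_betwI')
    fix j j' assume "j \<in> {1..t1}" "j' \<in> {1..t1}"
    then show "(\<sigma> j = \<sigma> j') = (j = j')" using inj[of "Inr j" "Inr j'"] \<sigma>[of j] \<sigma>[of j'] by (auto simp: I_iff)
  next
    fix j' assume "j' \<in> {1..t2}"
    then obtain x where x: "x \<in> I s1 t1" "\<phi> x = Inr j'" using surj[of "Inr j'"] by (auto simp: I_iff)
    then show "\<exists>j\<in>{1..t1}. j' = \<sigma> j" using \<pi> \<sigma> by (cases x) (auto simp: I_iff simp del: atLeastAtMost_iff)
  qed (use \<sigma> in blast)
  have st: "s2 = s1" "t2 = t1"
    using bij_betw_same_card[OF bij\<pi>] bij_betw_same_card[OF bij\<sigma>] by simp_all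
  let ?\<pi> = "\<lambda>i. if i \<in> {1..s1} then \<pi> i else i" and ?\<sigma> = "\<lambda>j. if j \<in> {1..t1} then \<sigma> j else j"
  have "?\<pi> permutes {1..s1}" "?\<sigma> permutes {1..t1}"
    using bij_betw_permutes bij\<pi> bij\<sigma> unfolding st by blast+
  moreover have "\<forall>i\<in>{1..s1}. eq_up_to_sign (f2 (?\<pi> i)) (f1 i)" using \<pi> by simp
  moreover have "\<forall>j\<in>{1..t1}. eq_up_to_sign (g2 (?\<sigma> j)) (g1 j)" using \<sigma> by simp
  ultimately show ?R using st by blast
qed

end
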